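(* If $1\le p<\infty$, $\alpha>-1$, $t>n+(\alpha+1)/p$ and $\mu\in\mathcal{M}_+$, then the Toeplitz operator $T_\mu$ is densely defined on $A_\alpha^p(T_B)$.
   Context: For $z=(z',z_n)\in\mathbb{C}^n$ with $z'=(z_1,\dots,z_{n-1})$, write $z'^2=z_1^2+\cdots+z_{n-1}^2$. Let $B=\{(y',y_n)\in\mathbb{R}^n: y_1^2+\cdots+y_{n-1}^2<y_n\}$ and $T_B=\{x+iy\in\mathbb{C}^n: x\in\mathbb{R}^n,\ y\in B\}$. Put $\rho(z,w)=\frac14\left((z'-\overline{w'})^2-2i(z_n-\overline{w_n})\right)$ and $\rho(z)=\rho(z,z)=y_n-y'^2$ for $z=x+iy$. For $z,w\in T_B$ one has $\operatorname{Re}\rho(z,w)>0$, and powers of $\rho(z,w)$ use the principal branch. Let $\mathbf{i}=(0',i)\in T_B$. For $\alpha>-1$ let $dV_\alpha(z)=\rho(z)^\alpha dV(z)$ with $dV$ Lebesgue measure on $\mathbb{C}^n$; $\|f\|_{p,\alpha}=\left(\int_{T_B}|f|^p\,dV_\alpha\right)^{1/p}$, and $A_\alpha^p(T_B)$ is the space of holomorphic $f$ on $T_B$ with $\|f\|_{p,\alpha}<\infty$. The weighted Bergman kernel is $$K_\alpha(z,w)=\frac{\Gamma(n+\alpha+1)}{2^{n+1}\pi^n\Gamma(\alpha+1)\,\rho(z,w)^{n+\alpha+1}}.$$ $\mathcal{M}_+$ is the set of all positive Borel measures $\mu$ on $T_B$ such that $\int_{T_B}|\rho(z,\mathbf{i})|^{-s}\,d\mu(z)<\infty$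 for some $s>0$. The Toeplitz operator is $T_\mu f(z)=\int_{T_B}K_\alpha(z,w)f(w)\,d\mu(w)$. "$T_\mu$ is densely defined on $A_\alpha^p(T_B)$" means that there is a dense linear subspace $S$ of $A_\alpha^p(T_B)$ such that $\int_{T_B}|K_\alpha(z,w)f(w)|\,d\mu(w)<\infty$ for every $f\in S$ and every $z\in T_B$. (The number $t$ does not occur in the conclusion; in the paper it is the exponent of the spaces $S_t$ of holomorphic $f$ on $T_B$ with $\sup_{z\in T_B}|\rho(z,\mathbf{i})|^t|f(z)|<\infty$.) *)

theory Defs
  imports "HOL-Analysis.Analysis"
begin

text \<open>
  Complex \<open>n\<close>-space is \<open>complex ^ 'n\<close> with \<open>'n\<close> a finite linearly ordered index type, so that
  \<open>n = CARD('n) \<ge> 1\<close> is arbitrary. The coordinate \<open>z\<^sub>n\<close> is the one at the largest index, and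
  \<open>z'\<close> consists of the remaining coordinates.
\<close>

definition last_ix :: "'n::{finite,linorder}" where
  "last_ix = Max UNIV"

text \<open>\<open>z'\<^sup>2 = z\<^sub>1\<^sup>2 + \<dots> + z\<^sub>n\<^sub>-\<^sub>1\<^sup>2\<close>, for real and for complex vectors (bilinear, not Hermitian).\<close>

definition prime_sq :: "'a::comm_semiring_1 ^ 'n::{finite,linorder} \<Rightarrow> 'a" where
  "prime_sq z = (\<Sum>j\<in>UNIV - {last_ix}. (z $ j)\<^sup>2)"

definition cnj_vec :: "complex ^ 'n \<Rightarrow> complex ^ 'n" where
  "cnj_vec z = (\<chi> j. cnj (z $ j))"

definition Im_vec :: "complex ^ 'n \<Rightarrow> real ^ 'n" where
  "Im_vec z = (\<chi> j. Im (z $ j))"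

definition base :: "(real ^ 'n::{finite,linorder}) set" where
  "base = {y. prime_sq y < y $ last_ix}"

definition tube :: "(complex ^ 'n::{finite,linorder}) set" where
  "tube = {z. Im_vec z \<in> base}"

definition rho :: "complex ^ 'n::{finite,linorder} \<Rightarrow> complex ^ 'n::{finite,linorder} \<Rightarrow> complex" where
  "rho z w = (prime_sq (z - cnj_vec w) - 2 * \<i> * (z $ last_ix - cnj (w $ last_ix))) / 4"

definition rho_diag :: "complex ^ 'n::{finite,linorder} \<Rightarrow> real" where
  "rho_diag z = Im_vec z $ last_ix - prime_sq (Im_vec z)"

lemma rho_same: "rho z z = complex_of_real (rho_diag z)"
proof -
  have "(z $ j - cnj (z $ j))\<^sup>2 = - 4 * complex_of_real ((Im (z $ j))\<^sup>2)" for j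
    by (simp add: complex_diff_cnj power_mult_distrib)
  then have "prime_sq (z - cnj_vec z) = - 4 * complex_of_real (prime_sq (Im_vec z))"
    by (simp add: prime_sq_def cnj_vec_def Im_vec_def sum_distrib_left sum_negf)
  then show ?thesis
    by (simp add: rho_def rho_diag_def Im_vec_def complex_eq_iff)
qed

lemma Re_rho_pos:
  assumes "z \<in> tube" "w \<in> tube"
  shows "Re (rho z w) > 0"
proof -
  have *: "- (2 * (Im a)\<^sup>2 + 2 * (Im b)\<^sup>2) \<le> Re ((a - cnj b)\<^sup>2)" for a b
  proof -
    have "0 \<le> (Re a - Re b)\<^sup>2 + (Im a - Im b)\<^sup>2" by simp
    then show ?thesis by (simp add: Re_power2 power2_eq_square algebra_simps)
  qed
  have "- (2 * prime_sq (Im_vec z) + 2 * prime_sq (Im_vec w))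
      = (\<Sum>j\<in>UNIV - {last_ix}. - (2 * (Im (z $ j))\<^sup>2 + 2 * (Im (w $ j))\<^sup>2))"
    by (simp add: prime_sq_def Im_vec_def sum_distrib_left sum.distrib sum_negf
        flip: minus_add_distrib)
  also have "\<dots> \<le> Re (prime_sq (z - cnj_vec w))"
    unfolding prime_sq_def cnj_vec_def Re_sum by (rule sum_mono) (use * in simp)
  finally show ?thesis
    using assms by (simp add: rho_def tube_def base_def Im_vec_def)
qed

definition i_point :: "complex ^ 'n::{finite,linorder}" where
  "i_point = axis last_ix \<i>"

definition dV :: "real \<Rightarrow> (complex ^ 'n::{finite,linorder}) measure" where
  "dV \<alpha> = density (restrict_space lborel tube) (\<lambda>z. ennreal (rho_diag z powr \<alpha>))"

text \<open>Holomorphy in several variables: a complex-linear Frechet derivative at every point.\<close>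

definition holomorphic_several :: "(complex ^ 'n \<Rightarrow> complex) \<Rightarrow> (complex ^ 'n) set \<Rightarrow> bool" where
  "holomorphic_several f U \<longleftrightarrow>
     (\<forall>z\<in>U. \<exists>D. (f has_derivative D) (at z) \<and> (\<forall>c v. D (c *s v) = c * D v))"

definition norm_pow_integral ::
    "real \<Rightarrow> real \<Rightarrow> (complex ^ 'n::{finite,linorder} \<Rightarrow> complex) \<Rightarrow> ennreal" where
  "norm_pow_integral p \<alpha> f = (\<integral>\<^sup>+ z. ennreal (norm (f z) powr p) \<partial>dV \<alpha>)"

text \<open>This is meaningful only where \<^const>\<open>norm_pow_integral\<close> is finite, as on the Bergman space.\<close>

definition bergman_norm ::
    "real \<Rightarrow> real \<Rightarrow> (complex ^ 'n::{finite,linorder} \<Rightarrow> complex) \<Rightarrow> real" where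
  "bergman_norm p \<alpha> f = enn2real (norm_pow_integral p \<alpha> f) powr (1 / p)"

text \<open>A function on the tube is represented by its extension by \<open>0\<close>, so that each element of the
  space has exactly one representative.\<close>

definition bergman_space ::
    "real \<Rightarrow> real \<Rightarrow> (complex ^ 'n::{finite,linorder} \<Rightarrow> complex) set" where
  "bergman_space p \<alpha> =
     {f. holomorphic_several f tube \<and> (\<forall>z. z \<notin> tube \<longrightarrow> f z = 0) \<and>
         norm_pow_integral p \<alpha> f < \<infinity>}"

definition bergman_kernel ::
    "real \<Rightarrow> complex ^ 'n::{finite,linorder} \<Rightarrow> complex ^ 'n::{finite,linorder} \<Rightarrow> complex" where
  "bergman_kernel \<alpha> z w =
     complex_of_real (Gamma (real CARD('n) + \<alpha> + 1)) /
     (complex_of_real (2 ^ (CARD('n) + 1) * pi ^ CARD('n) * Gamma (\<alpha> + 1)) *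
      rho z w powr complex_of_real (real CARD('n) + \<alpha> + 1))"

definition M_plus :: "(complex ^ 'n::{finite,linorder}) measure set" where
  "M_plus =
     {\<mu>. sets \<mu> = sets (restrict_space borel tube) \<and>
         (\<exists>s>0. (\<integral>\<^sup>+ z. ennreal (norm (rho z i_point) powr (- s)) \<partial>\<mu>) < \<infinity>)}"

definition toeplitz ::
    "real \<Rightarrow> (complex ^ 'n::{finite,linorder}) measure \<Rightarrow> (complex ^ 'n::{finite,linorder} \<Rightarrow> complex) \<Rightarrow>
     complex ^ 'n::{finite,linorder} \<Rightarrow> complex" where
  "toeplitz \<alpha> \<mu> f z = (\<integral>w. bergman_kernel \<alpha> z w * f w \<partial>\<mu>)"

definition dense_linear_subspace ::
    "real \<Rightarrow> real \<Rightarrow> (complex ^ 'n::{finite,linorder} \<Rightarrow> complex) set \<Rightarrow> bool" where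
  "dense_linear_subspace p \<alpha> S \<longleftrightarrow>
     S \<subseteq> bergman_space p \<alpha> \<and>
     (\<lambda>z. 0) \<in> S \<and>
     (\<forall>f\<in>S. \<forall>g\<in>S. (\<lambda>z. f z + g z) \<in> S) \<and>
     (\<forall>c. \<forall>f\<in>S. (\<lambda>z. c * f z) \<in> S) \<and>
     (\<forall>f\<in>bergman_space p \<alpha>. \<forall>\<epsilon>>0. \<exists>g\<in>S. bergman_norm p \<alpha> (\<lambda>z. f z - g z) < \<epsilon>)"

text \<open>The integral defining \<^const>\<open>toeplitz\<close> converges absolutely, at every point of the tube, for
  all functions in a dense linear subspace.\<close>

definition toeplitz_densely_defined ::
    "real \<Rightarrow> real \<Rightarrow> (complex ^ 'n::{finite,linorder}) measure \<Rightarrow> bool" where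
  "toeplitz_densely_defined p \<alpha> \<mu> \<longleftrightarrow>
     (\<exists>S. dense_linear_subspace p \<alpha> S \<and>
        (\<forall>f\<in>S. \<forall>z\<in>tube. (\<integral>\<^sup>+ w. ennreal (norm (bergman_kernel \<alpha> z w * f w)) \<partial>\<mu>) < \<infinity>))"

end

theory Submission
  imports Defs "HOL-Complex_Analysis.Complex_Analysis"
begin

text \<open>
  Choose \<open>s\<close> with \<open>\<bar>\<rho>(z, \<i>)\<bar>\<^sup>-\<^sup>s\<close> integrable against \<open>\<mu>\<close>. Since \<open>Re \<rho>(z, w) \<ge> (\<rho>(z) + \<rho>(w)) / 2\<close>,
  the kernel is bounded in \<open>w\<close> for fixed \<open>z\<close>, so it suffices that the functions of size
  \<open>O(\<bar>\<rho>(z, \<i>)\<bar>\<^sup>-\<^sup>s)\<close> are dense. Given \<open>f\<close>, the shifts \<open>f(z + v\<i>)\<close> grow at most linearly in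
  \<open>\<bar>\<rho>(z, \<i>)\<bar>\<close>, by a mean value inequality over balls moved by affine automorphisms of the domain, and
  multiplying by \<open>(1 + \<rho>(z, \<i>) / m)\<^sup>-\<^sup>N\<close> makes them decay. For \<open>\<alpha> < 0\<close> a single shift need
  not be bounded on the weighted space, but the average over \<open>0 \<le> v \<le> \<epsilon>\<close> of the weights
  \<open>(\<rho> - v)\<^sup>\<alpha>\<close>, taken as \<open>0\<close> where \<open>\<rho> \<le> v\<close>, is bounded by a constant times \<open>\<rho>\<^sup>\<alpha>\<close>; hence some
  shifts \<open>v\<^sub>m \<rightarrow> 0\<close> do not increase the norm in the limit, and pointwise convergence together with
  convergence of norms gives convergence in norm.
\<close>

section \<open>Linear images of Lebesgue measure\<close>

lemma emeasure_lborel_uminus: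
  fixes A :: "'a::euclidean_space set"
  assumes "A \<in> sets borel"
  shows "emeasure lborel (uminus -` A) = emeasure lborel A"
proof -
  have "lborel = distr lborel borel (uminus :: 'a \<Rightarrow> 'a)"
    using lborel_affine[of "-1" "0::'a"] by (simp add: density_1 one_ennreal_def[symmetric])
  then have "emeasure lborel A = emeasure (distr lborel borel (uminus :: 'a \<Rightarrow> 'a)) A" by simp
  also have "\<dots> = emeasure lborel (uminus -` A)"
    using assms by (subst emeasure_distr) auto
  finally show ?thesis by simp
qed

text \<open>Fubini for \<open>1\<^sub>A(x) 1\<^sub>B(x + y)\<close>, integrating \<open>y\<close> first or \<open>x\<close> first.\<close>

lemma translation_invariant_proportional:
  fixes M :: "'a::euclidean_space measure"
  assumes sets [measurable_cong]: "sets M = sets borel"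
    and "sigma_finite_measure M"
    and inv: "\<And>c. distr M borel (\<lambda>x. c + x) = M"
    and A [measurable]: "A \<in> sets borel" and B [measurable]: "B \<in> sets borel"
  shows "emeasure M A * emeasure lborel B = emeasure M B * emeasure lborel A"
proof -
  interpret M: sigma_finite_measure M by fact
  interpret P: pair_sigma_finite lborel M ..
  have [simp]: "space M = UNIV" using sets_eq_imp_space_eq[OF sets] by simp
  let ?I = "\<lambda>y x. indicator A x * indicator B (x + y) :: ennreal"
  have inner: "(\<integral>\<^sup>+ y. ?I y x \<partial>lborel) = indicator A x * emeasure lborel B" for x
  proof -
    have "(\<integral>\<^sup>+ y. indicator B (x + y) \<partial>lborel) = (\<integral>\<^sup>+ y. indicator B y \<partial>distr lborel borel (\<lambda>y. x + y))"
      by (subst nn_integral_distr) auto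
    also have "\<dots> = emeasure lborel B"
      by (simp add: lborel_distr_plus)
    finally show ?thesis
      by (subst nn_integral_cmult) auto
  qed
  have "emeasure M A * emeasure lborel B = (\<integral>\<^sup>+ x. indicator A x * emeasure lborel B \<partial>M)"
    by (subst nn_integral_multc) auto
  also have "\<dots> = (\<integral>\<^sup>+ x. \<integral>\<^sup>+ y. ?I y x \<partial>lborel \<partial>M)"
    by (simp add: inner)
  also have "\<dots> = (\<integral>\<^sup>+ y. \<integral>\<^sup>+ x. ?I y x \<partial>M \<partial>lborel)"
    by (rule P.Fubini') measurable
  also have "\<dots> = (\<integral>\<^sup>+ y. \<integral>\<^sup>+ x. indicator A (x - y) * indicator B x \<partial>M \<partial>lborel)"
  proof (rule nn_integral_cong)
    fix y :: 'a
    have "(\<integral>\<^sup>+ x. ?I y x \<partial>M) = (\<integral>\<^sup>+ x. ?I y x \<partial>distr M borel (\<lambda>x. - y + x))"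
      by (subst inv) (rule refl)
    also have "\<dots> = (\<integral>\<^sup>+ x. indicator A (x - y) * indicator B x \<partial>M)"
      by (subst nn_integral_distr) auto
    finally show "(\<integral>\<^sup>+ x. ?I y x \<partial>M) = (\<integral>\<^sup>+ x. indicator A (x - y) * indicator B x \<partial>M)" .
  qed
  also have "\<dots> = (\<integral>\<^sup>+ x. \<integral>\<^sup>+ y. indicator A (x - y) * indicator B x \<partial>lborel \<partial>M)"
    by (rule P.Fubini'[symmetric]) measurable
  also have "\<dots> = (\<integral>\<^sup>+ x. emeasure lborel A * indicator B x \<partial>M)"
  proof (rule nn_integral_cong)
    fix x :: 'a
    have "(\<integral>\<^sup>+ y. indicator A (x - y) \<partial>lborel)
        = (\<integral>\<^sup>+ y. (indicator A (- y) :: ennreal) \<partial>distr lborel borel (\<lambda>y. - x + y))"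
      by (subst nn_integral_distr) auto
    also have "\<dots> = (\<integral>\<^sup>+ y. indicator (uminus -` A) y \<partial>lborel)"
      unfolding lborel_distr_plus by (simp add: indicator_def)
    also have "\<dots> = emeasure lborel (uminus -` A)"
      by (subst nn_integral_indicator) (use measurable_sets_borel[of uminus borel A] in auto)
    finally show "(\<integral>\<^sup>+ y. indicator A (x - y) * indicator B x \<partial>lborel) = emeasure lborel A * indicator B x"
      by (subst nn_integral_multc) (auto simp: emeasure_lborel_uminus)
  qed
  also have "\<dots> = emeasure M B * emeasure lborel A"
    by (subst nn_integral_cmult) (auto simp: mult.commute)
  finally show ?thesis .
qed

lemma borel_measurable_linear:
  fixes T :: "'a::euclidean_space \<Rightarrow> 'b::euclidean_space"
  assumes "linear T"
  shows "T \<in> borel_measurable borel"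
  using assms
  by (simp add: borel_measurable_continuous_onI linear_continuous_on linear_conv_bounded_linear)

text \<open>The image measure is translation invariant because \<open>c + T x = T (S c + x)\<close>,
  and sigma-finite because the preimages of balls are bounded. The scaling factor stays
  unidentified; the cross-multiplied form avoids a division in \<open>ennreal\<close>.\<close>

lemma linear_distr_lborel_proportional:
  fixes T S :: "'a::euclidean_space \<Rightarrow> 'a"
  assumes T: "linear T" and S: "linear S" and TS: "\<And>x. T (S x) = x" and ST: "\<And>x. S (T x) = x"
    and A: "A \<in> sets borel" and B: "B \<in> sets borel"
  shows "emeasure lborel (T -` A) * emeasure lborel B = emeasure lborel (T -` B) * emeasure lborel A"
proof -
  have [measurable]: "T \<in> borel_measurable borel"
    by (rule borel_measurable_linear[OF T])
  let ?M = "distr lborel borel T"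
  have e: "emeasure ?M X = emeasure lborel (T -` X)" if "X \<in> sets borel" for X
    using that by (subst emeasure_distr) auto
  obtain K where K: "\<And>x. norm (S x) \<le> norm x * K"
    using S bounded_linear.bounded linear_conv_bounded_linear by blast
  have fin: "emeasure ?M (ball 0 (real n)) < \<infinity>" for n
  proof -
    have "bounded (T -` ball 0 (real n))"
    proof (rule boundedI[where B="real n * \<bar>K\<bar>"])
      fix x assume "x \<in> T -` ball 0 (real n)"
      then have "norm (T x) \<le> real n" by simp
      have "norm x \<le> norm (T x) * K" using K[of "T x"] ST by simp
      also have "\<dots> \<le> norm (T x) * \<bar>K\<bar>" by (simp add: mult_left_mono)
      also have "\<dots> \<le> real n * \<bar>K\<bar>" using \<open>norm (T x) \<le> real n\<close> by (simp add: mult_right_mono)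
      finally show "norm x \<le> real n * \<bar>K\<bar>" .
    qed
    moreover have "T -` ball 0 (real n) \<in> sets borel"
      using measurable_sets_borel[of T borel "ball 0 (real n)"] by simp
    ultimately show ?thesis using e emeasure_bounded_finite by simp
  qed
  have "sigma_finite_measure ?M"
  proof
    show "\<exists>A. countable A \<and> A \<subseteq> sets ?M \<and> \<Union> A = space ?M \<and> (\<forall>a\<in>A. emeasure ?M a \<noteq> \<infinity>)"
    proof (intro exI conjI ballI)
      show "\<Union> (range (\<lambda>n. ball 0 (real n))) = space ?M"
        using reals_Archimedean2 by auto
    qed (use fin in \<open>auto simp: less_top\<close>)
  qed
  moreover have "distr ?M borel (\<lambda>x. c + x) = ?M" for c
  proof -
    have "distr ?M borel (\<lambda>x. c + x) = distr lborel borel (\<lambda>x. T (S c + x))"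
      by (subst distr_distr) (auto simp: o_def linear_add[OF T] TS)
    also have "\<dots> = distr (distr lborel borel (\<lambda>x. S c + x)) borel T"
      by (subst distr_distr) (auto simp: o_def)
    finally show ?thesis by (simp add: lborel_distr_plus)
  qed
  ultimately have "emeasure ?M A * emeasure lborel B = emeasure ?M B * emeasure lborel A"
    by (intro translation_invariant_proportional A B) auto
  then show ?thesis by (simp add: e A B)
qed

lemma emeasure_lborel_ball_pos:
  assumes "r > 0"
  shows "emeasure lborel (ball (a::'a::euclidean_space) r) \<noteq> 0" "emeasure lborel (ball a r) \<noteq> \<infinity>"
proof -
  show "emeasure lborel (ball a r) \<noteq> 0"
    using content_ball_pos[OF assms, of a] by (auto simp: measure_def)
  show "emeasure lborel (ball a r) \<noteq> \<infinity>"
    using emeasure_bounded_finite[of "ball a r"] by simp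
qed

text \<open>Proportionality, applied to the preimage of the unit ball, whose own preimage is the
  unit ball again, shows that the scaling factor has square 1. Being nonnegative, it is 1.\<close>

lemma distr_lborel_involution:
  fixes T :: "'a::euclidean_space \<Rightarrow> 'a"
  assumes T: "linear T" and TT: "\<And>x. T (T x) = x"
  shows "distr lborel borel T = lborel"
proof (rule measure_eqI)
  have [measurable]: "T \<in> borel_measurable borel"
    by (rule borel_measurable_linear[OF T])
  fix A assume "A \<in> sets (distr lborel borel T)"
  then have A: "A \<in> sets borel" by simp
  let ?B = "ball (0::'a) 1"
  let ?b = "emeasure lborel ?B" and ?c = "emeasure lborel (T -` ?B)"
  note b = emeasure_lborel_ball_pos[of 1 "0::'a"]
  have eq: "emeasure lborel (T -` X) * ?b = ?c * emeasure lborel X" if "X \<in> sets borel" for X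
    using linear_distr_lborel_proportional[OF T T TT TT that, of ?B] by simp
  have TB: "T -` ?B \<in> sets borel" using measurable_sets_borel[of T borel ?B] by simp
  have "T -` (T -` ?B) = ?B" using TT by auto
  then have "?b * ?b = ?c * ?c" using eq[OF TB] by simp
  \<comment> \<open>Equal squares give equal numbers only after passing to finite real values; an
    infinite \<open>?c\<close> is excluded because \<open>?b * ?b\<close> is finite.\<close>
  then have "?b = ?c"
  proof (cases ?b rule: ennreal_cases)
    case (real r)
    show ?thesis
    proof (cases ?c rule: ennreal_cases)
      case (real r')
      with \<open>?b * ?b = ?c * ?c\<close> \<open>0 \<le> r\<close> \<open>?b = ennreal r\<close> have "r * r = r' * r'"
        by (simp flip: ennreal_mult)
      with \<open>0 \<le> r\<close> \<open>0 \<le> r'\<close> have "r = r'" by (simp add: power2_eq_iff_nonneg flip: power2_eq_square)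
      with real \<open>?b = ennreal r\<close> show ?thesis by simp
    qed (use \<open>?b * ?b = ?c * ?c\<close> real in \<open>simp add: ennreal_mult_eq_top_iff flip: ennreal_mult\<close>)
  qed (use b in simp)
  then have "?b * emeasure lborel (T -` A) = ?b * emeasure lborel A"
    using eq[OF A] by (simp add: mult.commute)
  then have "emeasure lborel (T -` A) = emeasure lborel A"
    using b by (simp add: ennreal_mult_cancel_left)
  then show "emeasure (distr lborel borel T) A = emeasure lborel A"
    using A by (subst emeasure_distr) auto
qed simp

text \<open>The unit ball is its own preimage, which fixes the scaling factor at 1. The intended
  maps are the scalar rotations of complex space.\<close>

lemma distr_lborel_isometry:
  fixes T S :: "'a::euclidean_space \<Rightarrow> 'a"
  assumes T: "linear T" and S: "linear S" and TS: "\<And>x. T (S x) = x" and ST: "\<And>x. S (T x) = x"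
    and norm: "\<And>x. norm (T x) = norm x"
  shows "distr lborel borel T = lborel"
proof (rule measure_eqI)
  have [measurable]: "T \<in> borel_measurable borel"
    by (rule borel_measurable_linear[OF T])
  fix A assume "A \<in> sets (distr lborel borel T)"
  then have A: "A \<in> sets borel" by simp
  let ?B = "ball (0::'a) 1"
  have TB: "T -` ?B = ?B" using norm by auto
  have "emeasure lborel (T -` A) * emeasure lborel ?B = emeasure lborel ?B * emeasure lborel A"
    using linear_distr_lborel_proportional[OF T S TS ST A, of ?B] by (simp add: TB)
  then have "emeasure lborel (T -` A) = emeasure lborel A"
    using emeasure_lborel_ball_pos[of 1 "0::'a"]
    by (simp add: ennreal_mult_cancel_left mult.commute[of _ "emeasure lborel ?B"])
  then show "emeasure (distr lborel borel T) A = emeasure lborel A"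
    using A by (subst emeasure_distr) auto
qed simp

section \<open>Mean value inequality for holomorphic functions on balls\<close>

lemma norm_vector_scalar_mult: "norm (c *s (v :: complex ^ 'n)) = norm c * norm v"
  by (simp add: norm_vec_def L2_set_def norm_mult power_mult_distrib
      sum_distrib_left[symmetric] real_sqrt_mult)

lemma linear_vector_scalar_mult: "linear (\<lambda>v :: complex ^ 'n. c *s v)"
  by (rule linearI) (auto simp: vec_eq_iff algebra_simps)

text \<open>By the chain rule the slice has derivative \<open>h \<mapsto> D (h *s \<zeta>)\<close>,
  and complex linearity of \<open>D\<close> turns this into multiplication by the number
  \<open>D \<zeta>\<close>.\<close>

lemma holomorphic_several_slice:
  assumes g: "holomorphic_several g U" and U: "\<And>u. u \<in> V \<Longrightarrow> u *s \<zeta> \<in> U"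
  shows "(\<lambda>u. g (u *s \<zeta>)) holomorphic_on V"
  unfolding holomorphic_on_def
proof
  fix u assume "u \<in> V"
  then obtain D where D: "(g has_derivative D) (at (u *s \<zeta>))" and lin: "\<And>c v. D (c *s v) = c * D v"
    using g U unfolding holomorphic_several_def by blast
  have "linear (\<lambda>u. u *s \<zeta>)"
    by (rule linearI) (auto simp: vec_eq_iff algebra_simps)
  then have "((\<lambda>u. u *s \<zeta>) has_derivative (\<lambda>u. u *s \<zeta>)) (at u)"
    by (simp add: linear_imp_has_derivative)
  from diff_chain_at[OF this D] have "((\<lambda>u. g (u *s \<zeta>)) has_derivative (\<lambda>h. h * D \<zeta>)) (at u)"
    by (simp add: o_def lin)
  then have "((\<lambda>u. g (u *s \<zeta>)) has_field_derivative D \<zeta>) (at u)"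
    by (simp add: has_field_derivative_def mult.commute[of _ "D \<zeta>"])
  then show "(\<lambda>u. g (u *s \<zeta>)) field_differentiable at u within V"
    using field_differentiable_at_within field_differentiable_def by blast
qed

text \<open>Cauchy's integral formula at the centre of the disc. The mean is stated as a nonnegative
  Lebesgue integral so that it can enter an exchange of integrals.\<close>

lemma holomorphic_circle_mean:
  assumes "h holomorphic_on V" "cball 0 1 \<subseteq> V"
  shows "ennreal (norm (h 0)) \<le> (\<integral>\<^sup>+ t. ennreal (norm (h (exp (2 * pi * \<i> * of_real t)))) * indicator {0..1} t \<partial>lborel)"
proof -
  let ?e = "\<lambda>t::real. exp (2 * pi * \<i> * of_real t)"
  have cp: "circlepath 0 1 t = ?e t" for t by (simp add: circlepath)
  have hol: "h holomorphic_on cball 0 1" using assms holomorphic_on_subset by blast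
  have "((\<lambda>u. h u / (u - 0)) has_contour_integral (2 * pi) * \<i> * h 0) (circlepath 0 1)"
    using Cauchy_integral_circlepath_simple[of h 0 1 0] hol by simp
  then have "((\<lambda>x. h (circlepath 0 1 x) / (circlepath 0 1 x) * vector_derivative (circlepath 0 1) (at x within {0..1}))
       has_integral (2 * pi) * \<i> * h 0) {0..1}"
    by (simp add: has_contour_integral_def)
  \<comment> \<open>The derivative of the path is \<open>2 * pi * \<i>\<close> times the path
    itself, so it cancels the denominator of the Cauchy kernel.\<close>
  then have "((\<lambda>x. (2 * pi) * \<i> * h (?e x)) has_integral (2 * pi) * \<i> * h 0) {0..1}"
    by (rule has_integral_eq[rotated]) (auto simp: vector_derivative_circlepath01 cp)
  from has_integral_mult_right[OF this, of "1 / (2 * pi * \<i>)"]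
  have int: "((\<lambda>x. h (?e x)) has_integral h 0) {0..1}" by simp
  have cont: "continuous_on {0..1} (\<lambda>x. h (?e x))"
    by (rule continuous_on_compose2[OF holomorphic_on_imp_continuous_on[OF hol]])
       (intro continuous_intros, simp add: image_subset_iff norm_exp_eq_Re)
  then have ni: "((\<lambda>x. norm (h (?e x))) has_integral integral {0..1} (\<lambda>x. norm (h (?e x)))) {0..1}"
    by (intro integrable_integral integrable_continuous_real continuous_intros)
  have "norm (h 0) \<le> integral {0..1} (\<lambda>x. norm (h (?e x)))"
    using integral_norm_bound_integral[OF has_integral_integrable[OF int] has_integral_integrable[OF ni] order_refl]
    unfolding integral_unique[OF int] .
  also have "ennreal (integral {0..1} (\<lambda>x. norm (h (?e x)))) = (\<integral>\<^sup>+ t. ennreal (norm (h (?e t))) * indicator {0..1} t \<partial>lborel)"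
    by (rule nn_integral_has_integral_lebesgue'[OF _ ni, symmetric]) auto
  finally show ?thesis by (simp add: ennreal_leI)
qed

lemma holomorphic_several_continuous_on:
  assumes "holomorphic_several f U"
  shows "continuous_on U f"
  using assms unfolding holomorphic_several_def
  by (metis continuous_at_imp_continuous_on has_derivative_continuous)

text \<open>Averaging the circle means of the slices \<open>u \<mapsto> g(u\<zeta>)\<close> over \<open>\<zeta>\<close> only needs the invariance of
  Lebesgue measure under \<open>\<zeta> \<mapsto> e\<^sup>i\<^sup>t\<zeta>\<close>, so no iteration over the coordinates.\<close>

lemma holomorphic_several_ball_mean:
  fixes g :: "complex ^ 'n \<Rightarrow> complex"
  assumes g: "holomorphic_several g (ball 0 r)" and r: "r > 0"
  shows "ennreal (norm (g 0)) * emeasure lborel (ball (0 :: complex ^ 'n) r)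
    \<le> (\<integral>\<^sup>+ \<zeta>. ennreal (norm (g \<zeta>)) * indicator (ball 0 r) \<zeta> \<partial>lborel)"
proof -
  let ?B = "ball (0 :: complex ^ 'n) r"
  let ?e = "\<lambda>t::real. exp (2 * pi * \<i> * of_real t)"
  define G where "G = (\<lambda>\<zeta>. ennreal (norm (indicator ?B \<zeta> *\<^sub>R g \<zeta>)))"
  \<comment> \<open>\<open>g\<close> is known to be continuous only on the ball, so Borel
    measurability on the whole space is obtained for its extension by 0.\<close>
  have [measurable]: "(\<lambda>\<zeta>. indicator ?B \<zeta> *\<^sub>R g \<zeta>) \<in> borel_measurable borel"
    by (rule borel_measurable_continuous_on_indicator)
       (auto intro: holomorphic_several_continuous_on[OF g])
  have [measurable]: "G \<in> borel_measurable borel" unfolding G_def by measurable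
  have Geq: "G \<zeta> = ennreal (norm (g \<zeta>)) * indicator ?B \<zeta>" for \<zeta>
    by (simp add: G_def indicator_def)
  have [measurable]: "(\<lambda>(t, \<zeta>). ?e t *s \<zeta>) \<in> borel_measurable (borel \<Otimes>\<^sub>M (borel :: (complex ^ 'n) measure))"
  proof -
    have "continuous_on UNIV (\<lambda>(t, \<zeta> :: complex ^ 'n). ?e t *s \<zeta>)"
      unfolding vector_scalar_mult_def case_prod_beta by (intro continuous_intros)
    then show ?thesis by (simp add: borel_prod borel_measurable_continuous_onI)
  qed
  have [measurable]: "(\<lambda>\<zeta> :: complex ^ 'n. ?e t *s \<zeta>) \<in> borel_measurable borel" for t
    by (intro borel_measurable_linear linear_vector_scalar_mult)
  have inner: "(\<integral>\<^sup>+ \<zeta>. G (?e t *s \<zeta>) \<partial>lborel) = (\<integral>\<^sup>+ \<zeta>. G \<zeta> \<partial>lborel)" for t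
  proof -
    have "distr lborel borel (\<lambda>\<zeta> :: complex ^ 'n. ?e t *s \<zeta>) = lborel"
      by (rule distr_lborel_isometry[where S = "\<lambda>\<zeta>. ?e (- t) *s \<zeta>"])
         (auto simp: linear_vector_scalar_mult norm_vector_scalar_mult norm_exp_eq_Re
           vector_smult_assoc exp_minus)
    moreover have "(\<integral>\<^sup>+ \<zeta>. G \<zeta> \<partial>distr lborel borel (\<lambda>\<zeta> :: complex ^ 'n. ?e t *s \<zeta>)) = (\<integral>\<^sup>+ \<zeta>. G (?e t *s \<zeta>) \<partial>lborel)"
      by (rule nn_integral_distr) measurable
    ultimately show ?thesis by simp
  qed
  have "ennreal (norm (g 0)) * emeasure lborel ?B = (\<integral>\<^sup>+ \<zeta>. ennreal (norm (g 0)) * indicator ?B \<zeta> \<partial>lborel)"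
    by (rule nn_integral_cmult_indicator[symmetric]) simp
  also have "\<dots> \<le> (\<integral>\<^sup>+ \<zeta>. \<integral>\<^sup>+ t. G (?e t *s \<zeta>) * indicator {0..1} t \<partial>lborel \<partial>lborel)"
  proof (rule nn_integral_mono)
    fix \<zeta> :: "complex ^ 'n"
    show "ennreal (norm (g 0)) * indicator ?B \<zeta> \<le> (\<integral>\<^sup>+ t. G (?e t *s \<zeta>) * indicator {0..1} t \<partial>lborel)"
    proof (cases "\<zeta> \<in> ?B")
      case True
      define V where "V = {u. u *s \<zeta> \<in> ?B}"
      have "(\<lambda>u. g (u *s \<zeta>)) holomorphic_on V"
        by (rule holomorphic_several_slice[OF g]) (simp add: V_def)
      moreover have "cball 0 1 \<subseteq> V"
      proof
        fix u :: complex assume "u \<in> cball 0 1"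
        then have "norm u * norm \<zeta> \<le> 1 * norm \<zeta>" by (intro mult_right_mono) auto
        then show "u \<in> V" using True by (simp add: V_def norm_vector_scalar_mult)
      qed
      ultimately have "ennreal (norm (g (0 *s \<zeta>)))
          \<le> (\<integral>\<^sup>+ t. ennreal (norm (g (?e t *s \<zeta>))) * indicator {0..1} t \<partial>lborel)"
        by (rule holomorphic_circle_mean)
      also have "\<dots> = (\<integral>\<^sup>+ t. G (?e t *s \<zeta>) * indicator {0..1} t \<partial>lborel)"
        using True by (intro nn_integral_cong) (simp add: Geq norm_vector_scalar_mult norm_exp_eq_Re)
      finally show ?thesis using True by simp
    qed simp
  qed
  also have "\<dots> = (\<integral>\<^sup>+ t. \<integral>\<^sup>+ \<zeta>. G (?e t *s \<zeta>) * indicator {0..1} t \<partial>lborel \<partial>lborel)"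
    by (rule lborel_pair.Fubini') measurable
  \<comment> \<open>Rotation invariance makes the inner integral independent of \<open>t\<close>,
    and the interval of \<open>t\<close> has length 1.\<close>
  also have "\<dots> = (\<integral>\<^sup>+ t. (\<integral>\<^sup>+ \<zeta>. G \<zeta> \<partial>lborel) * indicator {0..1::real} t \<partial>lborel)"
    by (intro nn_integral_cong, subst nn_integral_multc) (measurable, simp only: inner)
  also have "\<dots> = (\<integral>\<^sup>+ \<zeta>. G \<zeta> \<partial>lborel)"
    by (subst nn_integral_cmult) auto
  finally show ?thesis by (simp add: Geq)
qed

section \<open>Growth of Bergman functions\<close>

lemma rho_diag_eq: "rho_diag z = Im (z $ last_ix) - (\<Sum>j\<in>UNIV - {last_ix}. (Im (z $ j))\<^sup>2)"
  by (simp add: rho_diag_def prime_sq_def Im_vec_def)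

lemma tube_iff: "z \<in> tube \<longleftrightarrow> 0 < rho_diag z"
  by (simp add: tube_def base_def rho_diag_def)

lemma continuous_on_rho_diag: "continuous_on S rho_diag"
  unfolding rho_diag_eq[abs_def] by (intro continuous_intros)

lemma open_tube: "open (tube :: (complex ^ 'n::{finite,linorder}) set)"
proof -
  have "open {z :: complex ^ 'n::{finite,linorder}. 0 < rho_diag z}"
    by (intro open_Collect_less continuous_on_rho_diag continuous_intros)
  then show ?thesis by (simp add: tube_iff[symmetric])
qed

lemma measurable_rho_diag [measurable]: "rho_diag \<in> borel_measurable borel"
  by (intro borel_measurable_continuous_onI continuous_on_rho_diag)

lemma sets_tube [measurable]: "tube \<in> sets borel"
  by (intro borel_open open_tube)

lemma space_dV [simp]: "space (dV \<alpha>) = tube"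
  by (simp add: dV_def space_restrict_space)

lemma measurable_dV:
  assumes "f \<in> measurable borel N"
  shows "f \<in> measurable (dV \<alpha>) N"
  using assms by (simp add: dV_def measurable_restrict_space1)

text \<open>Moves the weight and the domain into the integrand, so that changes of variables and
  Fubini can be carried out for \<open>lborel\<close> on the whole space.\<close>

lemma nn_integral_dV:
  assumes [measurable]: "F \<in> borel_measurable borel"
  shows "(\<integral>\<^sup>+ z. F z \<partial>dV \<alpha>) = (\<integral>\<^sup>+ z. F z * (ennreal (rho_diag z powr \<alpha>) * indicator tube z) \<partial>lborel)"
proof -
  have "(\<integral>\<^sup>+ z. F z \<partial>dV \<alpha>) = (\<integral>\<^sup>+ z. ennreal (rho_diag z powr \<alpha>) * F z \<partial>restrict_space lborel tube)"
    unfolding dV_def by (rule nn_integral_density) (auto intro!: measurable_restrict_space1)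
  also have "\<dots> = (\<integral>\<^sup>+ z. ennreal (rho_diag z powr \<alpha>) * F z * indicator tube z \<partial>lborel)"
    by (rule nn_integral_restrict_space) auto
  finally show ?thesis by (simp add: mult_ac)
qed

text \<open>Each coordinate contributes the inequality
  \<open>(Re a - Re b)^2 + (Im a - Im b)^2 \<ge> 0\<close>. Unlike \<open>Re_rho_pos\<close> this is
  quantitative: it bounds both \<open>rho z w\<close> for fixed \<open>z\<close> and
  \<open>rho z i_point\<close> away from 0 on the tube.\<close>

lemma Re_rho_ge: "(rho_diag z + rho_diag w) / 2 \<le> Re (rho z w)"
proof -
  have *: "- (2 * (Im a)\<^sup>2 + 2 * (Im b)\<^sup>2) \<le> Re ((a - cnj b)\<^sup>2)" for a b
  proof -
    have "0 \<le> (Re a - Re b)\<^sup>2 + (Im a - Im b)\<^sup>2" by simp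
    then show ?thesis by (simp add: Re_power2 power2_eq_square algebra_simps)
  qed
  have "- (2 * (\<Sum>j\<in>UNIV - {last_ix}. (Im (z $ j))\<^sup>2) + 2 * (\<Sum>j\<in>UNIV - {last_ix}. (Im (w $ j))\<^sup>2))
      = (\<Sum>j\<in>UNIV - {last_ix}. - (2 * (Im (z $ j))\<^sup>2 + 2 * (Im (w $ j))\<^sup>2))"
    by (simp add: sum_distrib_left sum.distrib sum_negf flip: minus_add_distrib)
  also have "\<dots> \<le> Re (prime_sq (z - cnj_vec w))"
    unfolding prime_sq_def cnj_vec_def Re_sum by (rule sum_mono) (use * in simp)
  finally show ?thesis
    by (simp add: rho_def rho_diag_eq field_simps)
qed

text \<open>Extension by 0 outside the open tube turns continuity on the tube into Borel
  measurability on the whole space.\<close>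

lemma bergman_space_measurable:
  assumes "f \<in> bergman_space p \<alpha>"
  shows "f \<in> borel_measurable borel"
proof -
  have "(\<lambda>z. indicator tube z *\<^sub>R f z) \<in> borel_measurable borel"
    using assms by (intro borel_measurable_continuous_on_indicator sets_tube)
      (auto simp: bergman_space_def intro: holomorphic_several_continuous_on)
  also have "(\<lambda>z. indicator tube z *\<^sub>R f z) = f"
    using assms by (auto simp: bergman_space_def indicator_def fun_eq_iff)
  finally show ?thesis .
qed

text \<open>The linear part of a Heisenberg translation, composed with \<open>\<zeta>' \<mapsto> - \<zeta>'\<close>: this makes it
  an involution, so that it preserves Lebesgue measure without a determinant computation.\<close>

definition parabolic_involution ::
    "real ^ 'n::{finite,linorder} \<Rightarrow> complex ^ 'n::{finite,linorder} \<Rightarrow> complex ^ 'n::{finite,linorder}" where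
  "parabolic_involution a \<zeta> =
     (\<chi> j. if j = last_ix then \<zeta> $ j - 2 * (\<Sum>k\<in>UNIV - {last_ix}. of_real (a $ k) * \<zeta> $ k) else - (\<zeta> $ j))"

lemma parabolic_involution_involution: "parabolic_involution a (parabolic_involution a \<zeta>) = \<zeta>"
  by (simp add: parabolic_involution_def vec_eq_iff sum_negf)

lemma linear_parabolic_involution: "linear (parabolic_involution a)"
  by (rule linearI)
     (auto simp: parabolic_involution_def vec_eq_iff algebra_simps sum.distrib simp flip: scaleR_sum_right)

lemma parabolic_involution_scale: "parabolic_involution a (c *s \<zeta>) = c *s parabolic_involution a \<zeta>"
  by (auto simp: parabolic_involution_def vec_eq_iff algebra_simps sum_distrib_left)

text \<open>The shear in the last coordinate cancels the mixed terms of the squares. Hence moving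
  \<open>\<zeta>\<close> in a fixed ball changes \<open>rho_diag\<close> by an amount that does not
  depend on \<open>z\<close>, which makes the growth estimate uniform.\<close>

lemma rho_diag_parabolic_involution:
  "rho_diag (z + parabolic_involution (Im_vec z) \<zeta>)
    = rho_diag z + Im (\<zeta> $ last_ix) - (\<Sum>j\<in>UNIV - {last_ix}. (Im (\<zeta> $ j))\<^sup>2)"
proof -
  have "(Im (z $ j) - Im (\<zeta> $ j))\<^sup>2 = (Im (z $ j))\<^sup>2 + (Im (\<zeta> $ j))\<^sup>2 - 2 * (Im (z $ j) * Im (\<zeta> $ j))" for j
    by (simp add: power2_eq_square algebra_simps)
  then show ?thesis
    by (simp add: rho_diag_eq parabolic_involution_def Im_vec_def sum.distrib sum_subtractf
        sum_distrib_left)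
qed

lemma nn_integral_parabolic_involution:
  assumes [measurable]: "F \<in> borel_measurable borel"
  shows "(\<integral>\<^sup>+ \<zeta>. F (z + parabolic_involution a \<zeta>) \<partial>lborel) = (\<integral>\<^sup>+ \<zeta>. F \<zeta> \<partial>lborel)"
proof -
  have [measurable]: "parabolic_involution a \<in> borel_measurable borel"
    by (intro borel_measurable_linear linear_parabolic_involution)
  have "(\<integral>\<^sup>+ \<zeta>. F \<zeta> \<partial>lborel) = (\<integral>\<^sup>+ \<zeta>. F (z + \<zeta>) \<partial>lborel)"
    by (subst lborel_distr_plus[of z, symmetric], subst nn_integral_distr) auto
  also have "\<dots> = (\<integral>\<^sup>+ \<zeta>. F (z + parabolic_involution a \<zeta>) \<partial>lborel)"
    by (subst distr_lborel_involution[OF linear_parabolic_involution parabolic_involution_involution, of a, symmetric],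
        subst nn_integral_distr) auto
  finally show ?thesis by simp
qed

text \<open>For negative \<open>\<alpha>\<close> the weight decays, but \<open>t powr \<alpha> \<ge>
  (1 + s) powr \<alpha> \<ge> 1 / (1 + s)\<close> since \<open>\<alpha> > - 1\<close>; the factor
  \<open>1 + s\<close> compensates for this. In the application \<open>s\<close> is
  \<open>rho_diag\<close> at the centre of a moved ball, and \<open>t\<close> is its value at a
  point of that ball.\<close>

lemma weight_lower_bound:
  fixes \<alpha> s t u :: real
  assumes "\<alpha> > - 1" "0 < u" "u \<le> t" "t \<le> s + 1" "s > 0"
  shows "min 1 (u powr \<alpha>) \<le> t powr \<alpha> * (1 + s)"
proof (cases "\<alpha> \<ge> 0")
  case True
  have "u powr \<alpha> * 1 \<le> t powr \<alpha> * (1 + s)"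
    using assms True by (intro mult_mono powr_mono2) auto
  then show ?thesis by simp
next
  case False
  have "1 = (1 + s) powr (-1) * (1 + s)" using assms by (simp add: powr_minus field_simps)
  also have "\<dots> \<le> (1 + s) powr \<alpha> * (1 + s)" using assms by (intro mult_right_mono powr_mono) auto
  also have "\<dots> \<le> t powr \<alpha> * (1 + s)"
    using assms False by (intro mult_right_mono powr_mono2') auto
  finally show ?thesis by simp
qed

text \<open>The mean value inequality is applied on a ball of fixed radius, carried to
  \<open>z\<close> by a volume-preserving affine map. The linear growth comes from the factor
  \<open>1 + s\<close> in \<open>weight_lower_bound\<close>.\<close>

lemma bergman_space_growth:
  fixes f :: "complex ^ 'n::{finite,linorder} \<Rightarrow> complex"
  assumes f: "f \<in> bergman_space p \<alpha>" and p: "1 \<le> p" and \<alpha>: "\<alpha> > - 1" and v: "v > 0"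
  shows "\<exists>C\<ge>0. \<forall>z. v \<le> rho_diag z \<longrightarrow> norm (f z) \<le> C * (1 + rho_diag z)"
proof -
  \<comment> \<open>The last coordinate and the sum of squares each move \<open>rho_diag\<close> by
    at most \<open>r\<close>. So \<open>r \<le> v / 4\<close> keeps it at least
    \<open>v / 2\<close>, and \<open>r \<le> 1\<close> keeps it at most
    \<open>rho_diag z + 1\<close>.\<close>
  define r where "r = min 1 (v / 4)"
  define B where "B = ball (0 :: complex ^ 'n::{finite,linorder}) r"
  define c where "c = min 1 ((v / 2) powr \<alpha>)"
  define F where "F = (\<lambda>w. ennreal (norm (f w) powr p) * (ennreal (rho_diag w powr \<alpha>) * indicator tube w))"
  have r: "0 < r" "r \<le> 1" "r \<le> v / 4" using v by (auto simp: r_def)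
  have c: "c > 0" using v by (auto simp: c_def)
  note [measurable] = bergman_space_measurable[OF f]
  have [measurable]: "F \<in> borel_measurable borel" unfolding F_def by measurable
  have "norm_pow_integral p \<alpha> f = (\<integral>\<^sup>+ w. F w \<partial>lborel)"
    unfolding norm_pow_integral_def F_def by (rule nn_integral_dV) measurable
  then have "(\<integral>\<^sup>+ w. F w \<partial>lborel) < \<infinity>" using f by (simp add: bergman_space_def)
  then obtain I where I: "I \<ge> 0" "(\<integral>\<^sup>+ w. F w \<partial>lborel) = ennreal I"
    by (metis ennreal_cases infinity_ennreal_def less_irrefl)
  obtain V where V: "V > 0" "emeasure lborel B = ennreal V"
    using emeasure_lborel_ball_pos[OF r(1), of "0 :: complex ^ 'n::{finite,linorder}"] unfolding B_def
    by (metis ennreal_cases ennreal_0 infinity_ennreal_def less_eq_real_def)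
  have "norm (f z) \<le> (1 + I / (c * V)) * (1 + rho_diag z)" if z: "v \<le> rho_diag z" for z
  proof -
    let ?\<psi> = "\<lambda>\<zeta>. z + parabolic_involution (Im_vec z) \<zeta>"
    have psi: "v / 2 \<le> rho_diag (?\<psi> \<zeta>)" "rho_diag (?\<psi> \<zeta>) \<le> rho_diag z + 1" "?\<psi> \<zeta> \<in> tube" if "\<zeta> \<in> B" for \<zeta>
    proof -
      have n: "norm \<zeta> < r" using that by (simp add: B_def)
      have i: "\<bar>Im (\<zeta> $ last_ix)\<bar> \<le> r"
        using abs_Im_le_cmod[of "\<zeta> $ last_ix"] Finite_Cartesian_Product.norm_nth_le[of \<zeta> last_ix] n by linarith
      have "(\<Sum>j\<in>UNIV - {last_ix}. (Im (\<zeta> $ j))\<^sup>2) \<le> (\<Sum>j\<in>UNIV. (norm (\<zeta> $ j))\<^sup>2)"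
        by (rule order_trans[OF sum_mono sum_mono2]) (auto simp: abs_Im_le_cmod abs_le_square_iff[symmetric])
      also have "\<dots> = (norm \<zeta>)\<^sup>2" by (simp add: norm_vec_def L2_set_def sum_nonneg)
      also have "\<dots> \<le> r\<^sup>2" using n by (intro power_mono) auto
      also have "\<dots> \<le> r" using r by (simp add: power2_eq_square mult_left_le)
      finally have s: "(\<Sum>j\<in>UNIV - {last_ix}. (Im (\<zeta> $ j))\<^sup>2) \<le> r" .
      have s0: "0 \<le> (\<Sum>j\<in>UNIV - {last_ix}. (Im (\<zeta> $ j))\<^sup>2)" by (intro sum_nonneg) auto
      show "v / 2 \<le> rho_diag (?\<psi> \<zeta>)" "rho_diag (?\<psi> \<zeta>) \<le> rho_diag z + 1"
        using i s s0 r z unfolding rho_diag_parabolic_involution by linarith+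
      then show "?\<psi> \<zeta> \<in> tube" using v by (simp add: tube_iff)
    qed
    have "holomorphic_several (\<lambda>\<zeta>. f (?\<psi> \<zeta>)) B"
      unfolding holomorphic_several_def
    proof
      fix \<zeta> assume "\<zeta> \<in> B"
      then obtain D where D: "(f has_derivative D) (at (?\<psi> \<zeta>))" and lin: "\<And>c v. D (c *s v) = c * D v"
        using f psi(3) unfolding bergman_space_def holomorphic_several_def by blast
      have "(?\<psi> has_derivative parabolic_involution (Im_vec z)) (at \<zeta>)"
        using has_derivative_add[OF has_derivative_const
            linear_imp_has_derivative[OF linear_parabolic_involution]] by simp
      from diff_chain_at[OF this D]
      show "\<exists>D. ((\<lambda>\<zeta>. f (?\<psi> \<zeta>)) has_derivative D) (at \<zeta>) \<and> (\<forall>c v. D (c *s v) = c * D v)"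
        by (intro exI[of _ "\<lambda>v. D (parabolic_involution (Im_vec z) v)"])
           (simp add: o_def lin parabolic_involution_scale)
    qed
    from holomorphic_several_ball_mean[OF this[unfolded B_def] r(1), folded B_def]
    have "ennreal (norm (f z)) * ennreal V \<le> (\<integral>\<^sup>+ \<zeta>. ennreal (norm (f (?\<psi> \<zeta>))) * indicator B \<zeta> \<partial>lborel)"
      by (simp add: V linear_0[OF linear_parabolic_involution])
    also have "\<dots> \<le> (\<integral>\<^sup>+ \<zeta>. indicator B \<zeta> + ennreal ((1 + rho_diag z) / c) * F (?\<psi> \<zeta>) \<partial>lborel)"
    proof (rule nn_integral_mono)
      fix \<zeta>
      show "ennreal (norm (f (?\<psi> \<zeta>))) * indicator B \<zeta> \<le> indicator B \<zeta> + ennreal ((1 + rho_diag z) / c) * F (?\<psi> \<zeta>)"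
      proof (cases "\<zeta> \<in> B")
        case True
        let ?a = "norm (f (?\<psi> \<zeta>))"
        \<comment> \<open>This replaces Hoelder's inequality: the summand 1 costs only the volume of
          the ball, and the other summand is controlled by the Bergman norm.\<close>
        have "?a \<le> 1 + ?a powr p"
        proof (cases "?a \<le> 1")
          case False
          then have "?a powr 1 \<le> ?a powr p" using p by (intro powr_mono) auto
          then show ?thesis using False by simp
        qed (simp add: add_increasing2)
        also have "?a powr p \<le> ?a powr p * (rho_diag (?\<psi> \<zeta>) powr \<alpha> * (1 + rho_diag z) / c)"
        proof -
          have "c \<le> rho_diag (?\<psi> \<zeta>) powr \<alpha> * (1 + rho_diag z)"
            unfolding c_def using psi[OF True] v z \<alpha> by (intro weight_lower_bound) auto
          then have "1 \<le> rho_diag (?\<psi> \<zeta>) powr \<alpha> * (1 + rho_diag z) / c" using c by simp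
          from mult_left_mono[OF this, of "?a powr p"] show ?thesis by simp
        qed
        finally have "?a \<le> 1 + ((1 + rho_diag z) / c) * (?a powr p * rho_diag (?\<psi> \<zeta>) powr \<alpha>)"
          by (simp add: mult_ac)
        then have "ennreal ?a \<le> ennreal (1 + ((1 + rho_diag z) / c) * (?a powr p * rho_diag (?\<psi> \<zeta>) powr \<alpha>))"
          by (rule ennreal_leI)
        also have "\<dots> = 1 + ennreal ((1 + rho_diag z) / c) * (ennreal (?a powr p) * ennreal (rho_diag (?\<psi> \<zeta>) powr \<alpha>))"
          using c v z by (subst ennreal_plus; simp add: ennreal_mult' del: times_divide_eq_left)
        finally show ?thesis using True psi(3)[OF True] by (simp add: F_def)
      qed simp
    qed
    \<comment> \<open>The second summand carries no indicator of the ball, so its integral runs over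
      the whole space, where the change of variables gives \<open>I\<close> exactly.\<close>
    also have "\<dots> = ennreal V + ennreal ((1 + rho_diag z) / c) * ennreal I"
    proof -
      have [measurable]: "parabolic_involution (Im_vec z) \<in> borel_measurable borel"
        by (intro borel_measurable_linear linear_parabolic_involution)
      have [measurable]: "B \<in> sets borel" by (simp add: B_def)
      show ?thesis
        by (subst nn_integral_add, measurable, subst nn_integral_cmult, measurable)
           (simp add: nn_integral_parabolic_involution I V)
    qed
    finally have "norm (f z) * V \<le> V + (1 + rho_diag z) / c * I"
      using V I c v z by (simp flip: ennreal_mult ennreal_plus)
    then have "norm (f z) \<le> (V + (1 + rho_diag z) / c * I) / V"
      using V by (simp add: pos_le_divide_eq)
    also have "\<dots> = 1 + I / (c * V) * (1 + rho_diag z)" using V c by (simp add: field_simps)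
    also have "\<dots> \<le> (1 + rho_diag z) + I / (c * V) * (1 + rho_diag z)" using v z by simp
    finally show ?thesis by (simp add: algebra_simps)
  qed
  moreover have "0 \<le> 1 + I / (c * V)" using I V c by simp
  ultimately show ?thesis by blast
qed

section \<open>Algebra of holomorphic functions\<close>

text \<open>The norm of a sum is at most twice the larger norm. This crude bound takes the place of
  Minkowski's inequality below.\<close>

lemma norm_add_powr_le:
  fixes a b :: "'a::real_normed_vector"
  assumes "p \<ge> 0"
  shows "norm (a + b) powr p \<le> 2 powr p * (norm a powr p + norm b powr p)"
proof -
  have "norm (a + b) powr p \<le> (2 * max (norm a) (norm b)) powr p"
    using assms norm_triangle_ineq[of a b] by (intro powr_mono2) auto
  also have "\<dots> = 2 powr p * max (norm a) (norm b) powr p" by (simp add: powr_mult)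
  also have "max (norm a) (norm b) powr p \<le> norm a powr p + norm b powr p" by (auto simp: max_def)
  finally show ?thesis by simp
qed

lemma norm_pow_integral_mono:
  assumes "\<And>z. z \<in> tube \<Longrightarrow> norm (f z) \<le> norm (g z)" "p \<ge> 0"
  shows "norm_pow_integral p \<alpha> f \<le> norm_pow_integral p \<alpha> g"
  unfolding norm_pow_integral_def using assms
  by (intro nn_integral_mono ennreal_leI powr_mono2) auto

lemma norm_pow_integral_cmult:
  assumes [measurable]: "f \<in> borel_measurable borel"
  shows "norm_pow_integral p \<alpha> (\<lambda>z. c * f z) = ennreal (norm c powr p) * norm_pow_integral p \<alpha> f"
proof -
  have "(\<lambda>z. ennreal (norm (f z) powr p)) \<in> borel_measurable (dV \<alpha>)"
    by (rule measurable_dV) measurable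
  then have "(\<integral>\<^sup>+ z. ennreal (norm c powr p) * ennreal (norm (f z) powr p) \<partial>dV \<alpha>)
      = ennreal (norm c powr p) * norm_pow_integral p \<alpha> f"
    unfolding norm_pow_integral_def by (rule nn_integral_cmult)
  then show ?thesis
    by (simp add: norm_pow_integral_def norm_mult powr_mult ennreal_mult)
qed

lemma norm_pow_integral_add:
  assumes [measurable]: "f \<in> borel_measurable borel" "g \<in> borel_measurable borel" and p: "p \<ge> 0"
  shows "norm_pow_integral p \<alpha> (\<lambda>z. f z + g z)
    \<le> ennreal (2 powr p) * (norm_pow_integral p \<alpha> f + norm_pow_integral p \<alpha> g)"
proof -
  let ?f = "\<lambda>z. ennreal (norm (f z) powr p)" and ?g = "\<lambda>z. ennreal (norm (g z) powr p)"
  have m [measurable]: "?f \<in> borel_measurable (dV \<alpha>)" "?g \<in> borel_measurable (dV \<alpha>)"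
    by (rule measurable_dV, measurable)+
  have "norm_pow_integral p \<alpha> (\<lambda>z. f z + g z) \<le> (\<integral>\<^sup>+ z. ennreal (2 powr p) * (?f z + ?g z) \<partial>dV \<alpha>)"
    unfolding norm_pow_integral_def
  proof (rule nn_integral_mono)
    fix z
    show "ennreal (norm (f z + g z) powr p) \<le> ennreal (2 powr p) * (?f z + ?g z)"
      using ennreal_leI[OF norm_add_powr_le[OF p, of "f z" "g z"]] by (simp add: ennreal_mult)
  qed
  also have "\<dots> = ennreal (2 powr p) * (norm_pow_integral p \<alpha> f + norm_pow_integral p \<alpha> g)"
    unfolding norm_pow_integral_def nn_integral_add[OF m, symmetric]
    by (intro nn_integral_cmult borel_measurable_add m)
  finally show ?thesis .
qed

lemma holomorphic_several_const: "holomorphic_several (\<lambda>z. c) U"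
  unfolding holomorphic_several_def by (auto intro!: exI[of _ "\<lambda>_. 0"])

lemma holomorphic_several_component: "holomorphic_several (\<lambda>z. z $ j) U"
  unfolding holomorphic_several_def
  by (auto intro!: exI[of _ "\<lambda>v. v $ j"] bounded_linear_imp_has_derivative bounded_linear_vec_nth)

lemma holomorphic_several_add:
  assumes "holomorphic_several f U" "holomorphic_several g U"
  shows "holomorphic_several (\<lambda>z. f z + g z) U"
  unfolding holomorphic_several_def
proof
  fix z assume "z \<in> U"
  obtain D E where "(f has_derivative D) (at z)" "\<And>c v. D (c *s v) = c * D v"
    "(g has_derivative E) (at z)" "\<And>c v. E (c *s v) = c * E v"
    using assms \<open>z \<in> U\<close> unfolding holomorphic_several_def by blast
  then show "\<exists>D. ((\<lambda>z. f z + g z) has_derivative D) (at z) \<and> (\<forall>c v. D (c *s v) = c * D v)"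
    by (intro exI[of _ "\<lambda>v. D v + E v"]) (auto intro!: has_derivative_add simp: algebra_simps)
qed

lemma holomorphic_several_mult:
  assumes "holomorphic_several f U" "holomorphic_several g U"
  shows "holomorphic_several (\<lambda>z. f z * g z) U"
  unfolding holomorphic_several_def
proof
  fix z assume "z \<in> U"
  obtain D E where "(f has_derivative D) (at z)" "\<And>c v. D (c *s v) = c * D v"
    "(g has_derivative E) (at z)" "\<And>c v. E (c *s v) = c * E v"
    using assms \<open>z \<in> U\<close> unfolding holomorphic_several_def by blast
  then show "\<exists>D. ((\<lambda>z. f z * g z) has_derivative D) (at z) \<and> (\<forall>c v. D (c *s v) = c * D v)"
    by (intro exI[of _ "\<lambda>v. f z * E v + D v * g z"]) (auto intro: has_derivative_mult simp: distrib_left mult.left_commute mult.assoc)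
qed

lemma holomorphic_several_sum:
  assumes "finite A" "\<And>j. j \<in> A \<Longrightarrow> holomorphic_several (f j) U"
  shows "holomorphic_several (\<lambda>z. \<Sum>j\<in>A. f j z) U"
  using assms by (induction A rule: finite_induct)
    (auto intro: holomorphic_several_add holomorphic_several_const)

lemma holomorphic_several_power:
  assumes "holomorphic_several f U"
  shows "holomorphic_several (\<lambda>z. f z ^ k) U"
  by (induction k) (auto intro: holomorphic_several_mult holomorphic_several_const assms)

lemma holomorphic_several_inverse:
  assumes "holomorphic_several f U" "\<And>z. z \<in> U \<Longrightarrow> f z \<noteq> 0"
  shows "holomorphic_several (\<lambda>z. inverse (f z)) U"
  unfolding holomorphic_several_def
proof
  fix z assume "z \<in> U"
  obtain D where "(f has_derivative D) (at z)" "\<And>c v. D (c *s v) = c * D v"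
    using assms \<open>z \<in> U\<close> unfolding holomorphic_several_def by blast
  then show "\<exists>D. ((\<lambda>z. inverse (f z)) has_derivative D) (at z) \<and> (\<forall>c v. D (c *s v) = c * D v)"
    using Deriv.has_derivative_inverse[where f = f and x = z and f' = D and S = UNIV] assms(2)[OF \<open>z \<in> U\<close>]
    by (intro exI[of _ "\<lambda>v. - (inverse (f z) * D v * inverse (f z))"] conjI allI) simp_all
qed

text \<open>Derivatives are taken in the full space, so agreement on an open set is required. This
  transfers holomorphy to functions redefined as 0 outside the tube.\<close>

lemma holomorphic_several_transform:
  assumes f: "holomorphic_several f U" and U: "open U" and eq: "\<And>z. z \<in> U \<Longrightarrow> g z = f z"
  shows "holomorphic_several g U"
  unfolding holomorphic_several_def
proof
  fix z assume "z \<in> U"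
  then obtain D where D: "(f has_derivative D) (at z)" "\<And>c v. D (c *s v) = c * D v"
    using f unfolding holomorphic_several_def by blast
  have "(g has_derivative D) (at z)"
    by (rule has_derivative_transform_within_open[OF D(1) U \<open>z \<in> U\<close>]) (simp add: eq)
  with D show "\<exists>D. (g has_derivative D) (at z) \<and> (\<forall>c v. D (c *s v) = c * D v)" by blast
qed

lemma holomorphic_several_rho: "holomorphic_several (\<lambda>z. rho z w) U"
proof -
  have eq: "rho z w = (1 / 4) * ((\<Sum>j\<in>UNIV - {last_ix}. (z $ j + - cnj (w $ j))\<^sup>2)
      + (- 2 * \<i>) * (z $ last_ix + - cnj (w $ last_ix)))" for z
    by (simp add: rho_def prime_sq_def cnj_vec_def field_simps)
  show ?thesis
    unfolding eq
    by (intro holomorphic_several_add holomorphic_several_mult holomorphic_several_sum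
        holomorphic_several_power holomorphic_several_const holomorphic_several_component) simp
qed

lemma bergman_space_add:
  assumes f: "f \<in> bergman_space p \<alpha>" and g: "g \<in> bergman_space p \<alpha>" and p: "p \<ge> 0"
  shows "(\<lambda>z. f z + g z) \<in> bergman_space p \<alpha>"
proof -
  have "norm_pow_integral p \<alpha> (\<lambda>z. f z + g z)
      \<le> ennreal (2 powr p) * (norm_pow_integral p \<alpha> f + norm_pow_integral p \<alpha> g)"
    by (intro norm_pow_integral_add bergman_space_measurable[OF f] bergman_space_measurable[OF g] p)
  also have "\<dots> < \<infinity>"
    using f g by (simp add: bergman_space_def ennreal_mult_less_top)
  finally show ?thesis
    using f g by (simp add: bergman_space_def holomorphic_several_add)
qed

lemma bergman_space_cmult:
  assumes f: "f \<in> bergman_space p \<alpha>"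
  shows "(\<lambda>z. c * f z) \<in> bergman_space p \<alpha>"
  using f norm_pow_integral_cmult[OF bergman_space_measurable[OF f], of p \<alpha> c]
  by (simp add: bergman_space_def holomorphic_several_mult holomorphic_several_const ennreal_mult_less_top)

lemma bergman_space_mult_bounded:
  assumes f: "f \<in> bergman_space p \<alpha>" and p: "p \<ge> 0"
    and g: "holomorphic_several g tube" "\<And>z. z \<in> tube \<Longrightarrow> norm (g z) \<le> 1"
  shows "(\<lambda>z. f z * g z) \<in> bergman_space p \<alpha>"
proof -
  have "norm_pow_integral p \<alpha> (\<lambda>z. f z * g z) \<le> norm_pow_integral p \<alpha> f"
    using g p by (intro norm_pow_integral_mono) (auto simp: norm_mult intro: mult_left_le)
  then show ?thesis
    using f g by (auto simp: bergman_space_def intro: holomorphic_several_mult le_less_trans)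
qed

section \<open>Convergence in mean\<close>

text \<open>Split off a dominated part: \<open>\<bar>F\<^sub>n - f\<bar>\<^sup>p\<close> exceeds a multiple of \<open>\<bar>f\<bar>\<^sup>p\<close> by at most
  a multiple of \<open>\<bar>\<bar>F\<^sub>n\<bar>\<^sup>p - \<bar>f\<bar>\<^sup>p\<bar>\<close>, to which Scheffe's lemma applies.\<close>

lemma tendsto_nn_integral_norm_diff_powr:
  fixes F :: "nat \<Rightarrow> 'a \<Rightarrow> 'b::{banach, second_countable_topology}"
  assumes [measurable]: "\<And>n. F n \<in> borel_measurable M" "f \<in> borel_measurable M"
    and p: "p > 0"
    and fin: "(\<integral>\<^sup>+ x. ennreal (norm (f x) powr p) \<partial>M) < \<infinity>"
    and finF: "\<And>n. (\<integral>\<^sup>+ x. ennreal (norm (F n x) powr p) \<partial>M) < \<infinity>"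
    and lim: "AE x in M. (\<lambda>n. F n x) \<longlonglongrightarrow> f x"
    and limsup: "limsup (\<lambda>n. \<integral>\<^sup>+ x. ennreal (norm (F n x) powr p) \<partial>M) \<le> (\<integral>\<^sup>+ x. ennreal (norm (f x) powr p) \<partial>M)"
  shows "(\<lambda>n. \<integral>\<^sup>+ x. ennreal (norm (F n x - f x) powr p) \<partial>M) \<longlonglongrightarrow> 0"
proof -
  let ?h = "\<lambda>x. norm (f x) powr p" and ?H = "\<lambda>n x. norm (F n x) powr p"
  let ?d = "\<lambda>n x. norm (F n x - f x) powr p"
  have limh: "AE x in M. (\<lambda>n. ?H n x) \<longlonglongrightarrow> ?h x"
    using lim
  proof eventually_elim
    case (elim x)
    then show ?case
      using p by (intro tendsto_powr2 tendsto_norm tendsto_const) auto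
  qed
  \<comment> \<open>Scheffe's lemma for the \<open>p\<close>-th powers: they converge almost
    everywhere, and by hypothesis the limsup of their integrals does not exceed the integral of the
    limit.\<close>
  have "(\<lambda>n. \<integral>\<^sup>+ x. ennreal (norm (?H n x - ?h x)) \<partial>M) \<longlonglongrightarrow> 0"
  proof (rule Scheffe_lemma1)
    show "integrable M (?H n)" for n
      using finF by (intro integrableI_bounded) auto
    show "integrable M ?h"
      using fin by (intro integrableI_bounded) auto
  qed (use limh limsup in auto)
  from ennreal_tendsto_cmult[OF _ this, of "ennreal (2 powr p)"]
  have 1: "(\<lambda>n. ennreal (2 powr p) * (\<integral>\<^sup>+ x. ennreal (norm (?H n x - ?h x)) \<partial>M)) \<longlonglongrightarrow> 0"
    by simp
  \<comment> \<open>Cutting off at a multiple of the integrable function \<open>?h\<close> gives a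
    dominated sequence that tends to 0 almost everywhere.\<close>
  have "(\<lambda>n. \<integral>\<^sup>+ x. ennreal (min (?d n x) (2 powr p * (2 * ?h x))) \<partial>M) \<longlonglongrightarrow> (\<integral>\<^sup>+ x. 0 \<partial>M)"
  proof (rule nn_integral_dominated_convergence[where w = "\<lambda>x. ennreal (2 powr p * 2) * ennreal (?h x)"])
    show "AE x in M. ennreal (min (?d n x) (2 powr p * (2 * ?h x))) \<le> ennreal (2 powr p * 2) * ennreal (?h x)" for n
      by (intro AE_I2) (auto simp: ennreal_mult[symmetric] intro!: ennreal_leI)
    have "(\<integral>\<^sup>+ x. ennreal (2 powr p * 2) * ennreal (?h x) \<partial>M) = ennreal (2 powr p * 2) * (\<integral>\<^sup>+ x. ennreal (?h x) \<partial>M)"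
      by (rule nn_integral_cmult) measurable
    then show "(\<integral>\<^sup>+ x. ennreal (2 powr p * 2) * ennreal (?h x) \<partial>M) < \<infinity>"
      using fin by (simp add: ennreal_mult_less_top)
    show "AE x in M. (\<lambda>n. ennreal (min (?d n x) (2 powr p * (2 * ?h x)))) \<longlonglongrightarrow> 0"
      using lim
    proof eventually_elim
      case (elim x)
      then have "(\<lambda>n. norm (F n x - f x)) \<longlonglongrightarrow> 0"
        by (simp add: LIM_zero tendsto_norm_zero)
      then have "(\<lambda>n. ?d n x) \<longlonglongrightarrow> 0 powr p"
        using p by (intro tendsto_powr2 tendsto_const) auto
      then have "(\<lambda>n. min (?d n x) (2 powr p * (2 * ?h x))) \<longlonglongrightarrow> min (0 powr p) (2 powr p * (2 * ?h x))"
        by (intro tendsto_min tendsto_const)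
      from tendsto_ennrealI[OF this] show ?case by simp
    qed
  qed measurable
  then have 2: "(\<lambda>n. \<integral>\<^sup>+ x. ennreal (min (?d n x) (2 powr p * (2 * ?h x))) \<partial>M) \<longlonglongrightarrow> 0"
    by simp
  have le: "(\<integral>\<^sup>+ x. ennreal (?d n x) \<partial>M) \<le> (\<integral>\<^sup>+ x. ennreal (min (?d n x) (2 powr p * (2 * ?h x))) \<partial>M)
      + ennreal (2 powr p) * (\<integral>\<^sup>+ x. ennreal (norm (?H n x - ?h x)) \<partial>M)" for n
  proof -
    have "(\<integral>\<^sup>+ x. ennreal (?d n x) \<partial>M) \<le> (\<integral>\<^sup>+ x. ennreal (min (?d n x) (2 powr p * (2 * ?h x)))
        + ennreal (2 powr p) * ennreal (norm (?H n x - ?h x)) \<partial>M)"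
    proof (rule nn_integral_mono)
      fix x
      have "?d n x \<le> 2 powr p * (?H n x + ?h x)"
        using norm_add_powr_le[of p "F n x" "- f x"] p by simp
      \<comment> \<open>From \<open>?H n x \<le> ?h x + norm (?H n x - ?h x)\<close>: whatever
        exceeds the cut-off is charged to the difference handled by Scheffe's lemma.\<close>
      also have "\<dots> \<le> 2 powr p * (2 * ?h x + norm (?H n x - ?h x))"
        by (intro mult_left_mono) auto
      finally have "?d n x \<le> 2 powr p * (2 * ?h x) + 2 powr p * norm (?H n x - ?h x)"
        by (simp add: distrib_left)
      then have "?d n x \<le> min (?d n x) (2 powr p * (2 * ?h x)) + 2 powr p * norm (?H n x - ?h x)"
        by (auto simp: min_def)
      then show "ennreal (?d n x) \<le> ennreal (min (?d n x) (2 powr p * (2 * ?h x)))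
        + ennreal (2 powr p) * ennreal (norm (?H n x - ?h x))"
        by (simp add: ennreal_leI flip: ennreal_mult ennreal_plus)
    qed
    also have "\<dots> = (\<integral>\<^sup>+ x. ennreal (min (?d n x) (2 powr p * (2 * ?h x))) \<partial>M)
      + ennreal (2 powr p) * (\<integral>\<^sup>+ x. ennreal (norm (?H n x - ?h x)) \<partial>M)"
      by (subst nn_integral_add, measurable, subst nn_integral_cmult) auto
    finally show ?thesis .
  qed
  show ?thesis
    by (rule tendsto_sandwich[OF _ _ tendsto_const tendsto_add[OF 2 1, simplified]])
       (use le in \<open>auto intro!: always_eventually\<close>)
qed

section \<open>Averages of the shifted weights\<close>

text \<open>The value 0 for \<open>t \<le> 0\<close> builds the indicator of the tube into the
  weight: at \<open>rho_diag z - v\<close> it is the weight of the tube raised by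
  \<open>v\<close>.\<close>

definition positive_powr :: "real \<Rightarrow> real \<Rightarrow> ennreal" where
  "positive_powr \<alpha> t = ennreal (t powr \<alpha>) * indicator {0<..} t"

lemma measurable_positive_powr [measurable]: "positive_powr \<alpha> \<in> borel_measurable borel"
  unfolding positive_powr_def[abs_def] by measurable

lemma nn_integral_positive_powr:
  assumes \<alpha>: "\<alpha> > - 1" and r: "r > 0" and \<epsilon>: "\<epsilon> > 0"
  shows "(\<integral>\<^sup>+ v. positive_powr \<alpha> (r - v) * indicator {0..\<epsilon>} v \<partial>lborel)
    = ennreal ((r powr (\<alpha> + 1) - (max 0 (r - \<epsilon>)) powr (\<alpha> + 1)) / (\<alpha> + 1))"
proof -
  let ?a = "max 0 (r - \<epsilon>)"
  have "(\<integral>\<^sup>+ v. positive_powr \<alpha> (r - v) * indicator {0..\<epsilon>} v \<partial>lborel)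
      = (\<integral>\<^sup>+ v. positive_powr \<alpha> v * indicator {0..\<epsilon>} (r - v) \<partial>lborel)"
    by (subst nn_integral_real_affine[of _ "-1" r]) (auto simp: one_ennreal_def[symmetric])
  also have "\<dots> = (\<integral>\<^sup>+ v. ennreal (v powr \<alpha>) * indicator {?a..r} v \<partial>lborel)"
    by (intro nn_integral_cong) (auto simp: positive_powr_def indicator_def)
  also have "\<dots> = ennreal (r powr (\<alpha> + 1) / (\<alpha> + 1) - ?a powr (\<alpha> + 1) / (\<alpha> + 1))"
  proof (rule nn_integral_has_integral_lebesgue')
    show "((\<lambda>v. v powr \<alpha>) has_integral r powr (\<alpha> + 1) / (\<alpha> + 1) - ?a powr (\<alpha> + 1) / (\<alpha> + 1)) {?a..r}"
    \<comment> \<open>The antiderivative is continuous at 0 because \<open>\<alpha> + 1 > 0\<close>,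
      but for \<open>\<alpha> < 0\<close> it is not differentiable there, and 0 can be the left
      endpoint.\<close>
    proof (rule fundamental_theorem_of_calculus_interior)
      show "continuous_on {?a..r} (\<lambda>v. v powr (\<alpha> + 1) / (\<alpha> + 1))"
        using \<alpha> by (intro continuous_intros continuous_on_powr') auto
      fix x assume "x \<in> {?a<..<r}"
      then show "((\<lambda>v. v powr (\<alpha> + 1) / (\<alpha> + 1)) has_vector_derivative x powr \<alpha>) (at x)"
        using \<alpha> by (auto intro!: derivative_eq_intros
            simp: has_real_derivative_iff_has_vector_derivative[symmetric])
    qed (use r \<epsilon> in auto)
  qed auto
  finally show ?thesis by (simp add: diff_divide_distrib)
qed

text \<open>If \<open>\<epsilon> \<le> r / 2\<close>, then \<open>r - v\<close> stays between
  \<open>r / 2\<close> and \<open>r\<close>, and the integrand is comparable to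
  \<open>r powr \<alpha>\<close>. Otherwise \<open>r < 2 * \<epsilon>\<close>, and the full integral
  \<open>r powr (\<alpha> + 1) / (\<alpha> + 1)\<close> is small enough. The constant adds the
  bounds of both cases.\<close>

lemma nn_integral_positive_powr_le:
  assumes \<alpha>: "\<alpha> > - 1" and \<epsilon>: "\<epsilon> > 0"
  shows "(\<integral>\<^sup>+ v. positive_powr \<alpha> (r - v) * indicator {0..\<epsilon>} v \<partial>lborel)
    \<le> ennreal (\<epsilon> * (2 powr \<bar>\<alpha>\<bar> + 2 / (\<alpha> + 1))) * positive_powr \<alpha> r"
proof (cases "r > 0")
  case False
  then have "(\<integral>\<^sup>+ v. positive_powr \<alpha> (r - v) * indicator {0..\<epsilon>} v \<partial>lborel) = (\<integral>\<^sup>+ v. 0 \<partial>(lborel :: real measure))"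
    by (intro nn_integral_cong) (auto simp: positive_powr_def indicator_def)
  then show ?thesis by simp
next
  case r: True
  show ?thesis
  proof (cases "\<epsilon> \<le> r / 2")
    case True
    have "(\<integral>\<^sup>+ v. positive_powr \<alpha> (r - v) * indicator {0..\<epsilon>} v \<partial>lborel)
        \<le> (\<integral>\<^sup>+ v. ennreal (2 powr \<bar>\<alpha>\<bar> * r powr \<alpha>) * indicator {0..\<epsilon>} v \<partial>lborel)"
    proof (rule nn_integral_mono)
      fix v
      show "positive_powr \<alpha> (r - v) * indicator {0..\<epsilon>} v \<le> ennreal (2 powr \<bar>\<alpha>\<bar> * r powr \<alpha>) * indicator {0..\<epsilon>} v"
      proof (cases "v \<in> {0..\<epsilon>}")
        case v: True
        have "(r - v) powr \<alpha> \<le> 2 powr \<bar>\<alpha>\<bar> * r powr \<alpha>"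
        proof (cases "\<alpha> \<ge> 0")
          case pos: True
          have "(r - v) powr \<alpha> \<le> 1 * r powr \<alpha>" using v pos True r by (auto intro: powr_mono2)
          also have "\<dots> \<le> 2 powr \<bar>\<alpha>\<bar> * r powr \<alpha>" by (intro mult_right_mono ge_one_powr_ge_zero) auto
          finally show ?thesis .
        next
          case neg: False
          have "(r - v) powr \<alpha> \<le> (r / 2) powr \<alpha>" using v neg True r by (intro powr_mono2') auto
          also have "\<dots> = 2 powr \<bar>\<alpha>\<bar> * r powr \<alpha>"
            using neg r by (simp add: powr_divide powr_minus field_simps)
          finally show ?thesis .
        qed
        then show ?thesis by (auto simp: positive_powr_def indicator_def intro: ennreal_leI)
      qed simp
    qed
    also have "\<dots> = ennreal (2 powr \<bar>\<alpha>\<bar> * r powr \<alpha>) * ennreal \<epsilon>"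
      using \<epsilon> by (subst nn_integral_cmult_indicator) auto
    also have "\<dots> = ennreal (\<epsilon> * 2 powr \<bar>\<alpha>\<bar>) * positive_powr \<alpha> r"
      using r \<epsilon> by (simp add: positive_powr_def mult_ac flip: ennreal_mult)
    also have "\<dots> \<le> ennreal (\<epsilon> * (2 powr \<bar>\<alpha>\<bar> + 2 / (\<alpha> + 1))) * positive_powr \<alpha> r"
      using \<alpha> \<epsilon> by (intro mult_right_mono ennreal_leI mult_left_mono) auto
    finally show ?thesis .
  next
    case False
    have "(r powr (\<alpha> + 1) - (max 0 (r - \<epsilon>)) powr (\<alpha> + 1)) / (\<alpha> + 1) \<le> r powr (\<alpha> + 1) / (\<alpha> + 1)"
      using \<alpha> by (intro divide_right_mono) auto
    also have "\<dots> = r * r powr \<alpha> / (\<alpha> + 1)" using r by (simp add: powr_add)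
    also have "\<dots> \<le> (2 * \<epsilon>) * r powr \<alpha> / (\<alpha> + 1)"
      using \<alpha> False by (intro divide_right_mono mult_right_mono) auto
    also have "\<dots> = (\<epsilon> * (2 / (\<alpha> + 1))) * r powr \<alpha>" by simp
    also have "\<dots> \<le> (\<epsilon> * (2 powr \<bar>\<alpha>\<bar> + 2 / (\<alpha> + 1))) * r powr \<alpha>"
      using \<epsilon> by (intro mult_right_mono mult_left_mono) auto
    finally have "ennreal ((r powr (\<alpha> + 1) - (max 0 (r - \<epsilon>)) powr (\<alpha> + 1)) / (\<alpha> + 1))
        \<le> ennreal ((\<epsilon> * (2 powr \<bar>\<alpha>\<bar> + 2 / (\<alpha> + 1))) * r powr \<alpha>)"
      by (rule ennreal_leI)
    also have "\<dots> = ennreal (\<epsilon> * (2 powr \<bar>\<alpha>\<bar> + 2 / (\<alpha> + 1))) * positive_powr \<alpha> r"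
      using r by (simp add: positive_powr_def ennreal_mult'')
    finally show ?thesis by (simp add: nn_integral_positive_powr[OF \<alpha> r \<epsilon>])
  qed
qed

text \<open>For small intervals the average is the difference quotient of
  \<open>t powr (\<alpha> + 1) / (\<alpha> + 1)\<close> at \<open>r\<close> with the negative step
  \<open>- 1 / Suc m\<close>.\<close>

lemma tendsto_average_positive_powr:
  assumes \<alpha>: "\<alpha> > - 1"
  shows "(\<lambda>m. ennreal (real (Suc m)) *
      (\<integral>\<^sup>+ v. positive_powr \<alpha> (r - v) * indicator {0..1 / real (Suc m)} v \<partial>lborel)) \<longlonglongrightarrow> positive_powr \<alpha> r"
proof (cases "r > 0")
  case False
  then have "(\<integral>\<^sup>+ v. positive_powr \<alpha> (r - v) * indicator {0..1 / real (Suc m)} v \<partial>lborel) = (\<integral>\<^sup>+ v. 0 \<partial>(lborel :: real measure))" for m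
    by (intro nn_integral_cong) (auto simp: positive_powr_def indicator_def)
  then show ?thesis using False by (simp add: positive_powr_def)
next
  case r: True
  let ?G = "\<lambda>t. t powr (\<alpha> + 1) / (\<alpha> + 1)"
  let ?\<epsilon> = "\<lambda>m. 1 / real (Suc m)"
  have "(?G has_real_derivative r powr \<alpha>) (at r)"
    using \<alpha> r by (auto intro!: derivative_eq_intros)
  then have "((\<lambda>h. (?G (r + h) - ?G r) / h) \<longlongrightarrow> r powr \<alpha>) (at 0)"
    by (simp add: DERIV_def)
  moreover have "filterlim (\<lambda>m. - ?\<epsilon> m) (at 0) sequentially"
  proof (rule filterlim_atI)
    show "(\<lambda>m. - ?\<epsilon> m) \<longlonglongrightarrow> 0"
      using tendsto_minus[OF LIMSEQ_inverse_real_of_nat] by (simp add: inverse_eq_divide)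
  qed (auto intro: always_eventually)
  ultimately have "(\<lambda>m. (?G (r + - ?\<epsilon> m) - ?G r) / - ?\<epsilon> m) \<longlonglongrightarrow> r powr \<alpha>"
    by (rule filterlim_compose)
  then have lim: "(\<lambda>m. ennreal ((?G (r + - ?\<epsilon> m) - ?G r) / - ?\<epsilon> m)) \<longlonglongrightarrow> positive_powr \<alpha> r"
    using r by (simp add: positive_powr_def tendsto_ennrealI)
  have "(\<lambda>m. ?\<epsilon> m) \<longlonglongrightarrow> 0"
    using LIMSEQ_inverse_real_of_nat by (simp add: inverse_eq_divide)
  then have ev: "\<forall>\<^sub>F m in sequentially. ?\<epsilon> m < r"
    using r order_tendstoD(2) by blast
  show ?thesis
  proof (rule Lim_transform_eventually[OF lim eventually_mono[OF ev]])
    fix m assume m: "?\<epsilon> m < r"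
    have "?\<epsilon> m > 0" by simp
    have eq: "(?G (r + - ?\<epsilon> m) - ?G r) / - ?\<epsilon> m
        = real (Suc m) * ((r powr (\<alpha> + 1) - (max 0 (r - ?\<epsilon> m)) powr (\<alpha> + 1)) / (\<alpha> + 1))"
    proof -
      have "(x / b - y / b) / - (1 / k) = k * ((y - x) / b)" if "k \<noteq> 0" for x y b k :: real
        using that by (cases "b = 0") (auto simp: field_simps)
      from this[of "real (Suc m)"] show ?thesis using m by simp
    qed
    show "ennreal ((?G (r + - ?\<epsilon> m) - ?G r) / - ?\<epsilon> m) = ennreal (real (Suc m)) *
      (\<integral>\<^sup>+ v. positive_powr \<alpha> (r - v) * indicator {0..?\<epsilon> m} v \<partial>lborel)"
      unfolding nn_integral_positive_powr[OF \<alpha> r \<open>?\<epsilon> m > 0\<close>] eq by (rule ennreal_mult') simp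
  qed
qed

section \<open>Approximation by vertical shifts\<close>

lemma rho_diag_vertical_shift: "rho_diag (z + of_real v *s i_point) = rho_diag z + v"
  by (simp add: rho_diag_eq i_point_def axis_def)

lemma tube_vertical_shift: "z \<in> tube \<Longrightarrow> v \<ge> 0 \<Longrightarrow> z + of_real v *s i_point \<in> tube"
  by (simp add: tube_iff rho_diag_vertical_shift)

text \<open>Translation moves the shift from the function to the weight, so that different shifts
  share one integrand \<open>F\<close> and only the weights vary.\<close>

lemma nn_integral_dV_vertical_shift:
  assumes [measurable]: "F \<in> borel_measurable borel"
  shows "(\<integral>\<^sup>+ z. F (z + of_real v *s i_point) \<partial>dV \<alpha>) = (\<integral>\<^sup>+ z. F z * positive_powr \<alpha> (rho_diag z - v) \<partial>lborel)"
proof -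
  let ?c = "of_real v *s i_point"
  have "(\<integral>\<^sup>+ z. F z * positive_powr \<alpha> (rho_diag z - v) \<partial>lborel)
      = (\<integral>\<^sup>+ z. F (?c + z) * positive_powr \<alpha> (rho_diag (?c + z) - v) \<partial>lborel)"
    by (subst lborel_distr_plus[of ?c, symmetric], subst nn_integral_distr) auto
  also have "\<dots> = (\<integral>\<^sup>+ z. F (z + ?c) * (ennreal (rho_diag z powr \<alpha>) * indicator tube z) \<partial>lborel)"
    by (simp add: add.commute[of ?c] rho_diag_vertical_shift positive_powr_def indicator_def tube_iff)
  also have "\<dots> = (\<integral>\<^sup>+ z. F (z + ?c) \<partial>dV \<alpha>)"
    by (rule nn_integral_dV[symmetric]) measurable
  finally show ?thesis by simp
qed

lemma norm_pow_integral_eq_lborel: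
  assumes [measurable]: "f \<in> borel_measurable borel"
  shows "norm_pow_integral p \<alpha> f = (\<integral>\<^sup>+ z. ennreal (norm (f z) powr p) * positive_powr \<alpha> (rho_diag z) \<partial>lborel)"
  using nn_integral_dV_vertical_shift[of "\<lambda>z. ennreal (norm (f z) powr p)" \<alpha> 0]
  by (simp add: norm_pow_integral_def)

text \<open>After exchanging integrals, the average of the norms is the integral of \<open>h\<close>
  against the averaged weight \<open>A m\<close>. These weights converge pointwise and are dominated
  by a multiple of the original weight.\<close>

lemma tendsto_average_norm_pow_integral_shift:
  fixes f :: "complex ^ 'n::{finite,linorder} \<Rightarrow> complex"
  assumes f: "f \<in> bergman_space p \<alpha>" and \<alpha>: "\<alpha> > - 1"
  shows "(\<lambda>m. ennreal (real (Suc m)) * (\<integral>\<^sup>+ v. norm_pow_integral p \<alpha> (\<lambda>z. f (z + of_real v *s i_point)) *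
      indicator {0..1 / real (Suc m)} v \<partial>lborel)) \<longlonglongrightarrow> norm_pow_integral p \<alpha> f"
proof -
  note [measurable] = bergman_space_measurable[OF f]
  define h where "h = (\<lambda>z. ennreal (norm (f z) powr p))"
  have [measurable]: "h \<in> borel_measurable borel" unfolding h_def by measurable
  define A where "A = (\<lambda>m r. ennreal (real (Suc m)) *
    (\<integral>\<^sup>+ v. positive_powr \<alpha> (r - v) * indicator {0..1 / real (Suc m)} v \<partial>lborel))"
  have [measurable]: "A m \<in> borel_measurable borel" for m
    unfolding A_def by measurable
  define C where "C = 2 powr \<bar>\<alpha>\<bar> + 2 / (\<alpha> + 1)"
  have C: "C \<ge> 0" using \<alpha> by (simp add: C_def)
  \<comment> \<open>The factor \<open>Suc m\<close> cancels the interval length in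
    \<open>nn_integral_positive_powr_le\<close>, so one constant \<open>C\<close> serves all
    \<open>m\<close>.\<close>
  have A_le: "A m r \<le> ennreal C * positive_powr \<alpha> r" for m r
  proof -
    have "A m r \<le> ennreal (real (Suc m)) * (ennreal (1 / real (Suc m) * C) * positive_powr \<alpha> r)"
      unfolding A_def C_def by (intro mult_left_mono nn_integral_positive_powr_le \<alpha>) auto
    also have "\<dots> = ennreal (real (Suc m) * (1 / real (Suc m) * C)) * positive_powr \<alpha> r"
      using C by (simp only: ennreal_mult' mult.assoc of_nat_0_le_iff)
    finally show ?thesis by simp
  qed
  have eq: "ennreal (real (Suc m)) * (\<integral>\<^sup>+ v. norm_pow_integral p \<alpha> (\<lambda>z. f (z + of_real v *s i_point)) *
      indicator {0..1 / real (Suc m)} v \<partial>lborel) = (\<integral>\<^sup>+ z. h z * A m (rho_diag z) \<partial>lborel)" for m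
  proof -
    have "(\<integral>\<^sup>+ v. norm_pow_integral p \<alpha> (\<lambda>z. f (z + of_real v *s i_point)) * indicator {0..1 / real (Suc m)} v \<partial>lborel)
        = (\<integral>\<^sup>+ v. \<integral>\<^sup>+ z. h z * positive_powr \<alpha> (rho_diag z - v) * indicator {0..1 / real (Suc m)} v \<partial>lborel \<partial>lborel)"
      unfolding norm_pow_integral_def h_def
      by (intro nn_integral_cong, subst nn_integral_multc, measurable,
          subst nn_integral_dV_vertical_shift[of "\<lambda>z. ennreal (norm (f z) powr p)"]) auto
    also have "\<dots> = (\<integral>\<^sup>+ z. \<integral>\<^sup>+ v. h z * positive_powr \<alpha> (rho_diag z - v) * indicator {0..1 / real (Suc m)} v \<partial>lborel \<partial>lborel)"
      by (rule lborel_pair.Fubini') measurable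
    also have "\<dots> = (\<integral>\<^sup>+ z. h z * (\<integral>\<^sup>+ v. positive_powr \<alpha> (rho_diag z - v) * indicator {0..1 / real (Suc m)} v \<partial>lborel) \<partial>lborel)"
      by (intro nn_integral_cong, subst nn_integral_cmult[symmetric]) (auto simp: mult.assoc)
    finally have "ennreal (real (Suc m)) * (\<integral>\<^sup>+ v. norm_pow_integral p \<alpha> (\<lambda>z. f (z + of_real v *s i_point)) *
        indicator {0..1 / real (Suc m)} v \<partial>lborel)
      = (\<integral>\<^sup>+ z. ennreal (real (Suc m)) * (h z * (\<integral>\<^sup>+ v. positive_powr \<alpha> (rho_diag z - v) *
          indicator {0..1 / real (Suc m)} v \<partial>lborel)) \<partial>lborel)"
      by (subst nn_integral_cmult) auto
    then show ?thesis by (simp only: A_def mult.left_commute)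
  qed
  have "(\<lambda>m. \<integral>\<^sup>+ z. h z * A m (rho_diag z) \<partial>lborel) \<longlonglongrightarrow> (\<integral>\<^sup>+ z. h z * positive_powr \<alpha> (rho_diag z) \<partial>lborel)"
  proof (rule nn_integral_dominated_convergence[where w = "\<lambda>z. ennreal C * (h z * positive_powr \<alpha> (rho_diag z))"])
    show "AE z in lborel. h z * A m (rho_diag z) \<le> ennreal C * (h z * positive_powr \<alpha> (rho_diag z))" for m
      using mult_left_mono[OF A_le, of "h _"] by (auto simp: mult.left_commute)
    have "(\<integral>\<^sup>+ z. ennreal C * (h z * positive_powr \<alpha> (rho_diag z)) \<partial>lborel) = ennreal C * norm_pow_integral p \<alpha> f"
      by (subst nn_integral_cmult) (auto simp: norm_pow_integral_eq_lborel h_def)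
    also have "\<dots> < \<infinity>" using f by (simp add: bergman_space_def ennreal_mult_less_top)
    finally show "(\<integral>\<^sup>+ z. ennreal C * (h z * positive_powr \<alpha> (rho_diag z)) \<partial>lborel) < \<infinity>" .
    show "AE z in lborel. (\<lambda>m. h z * A m (rho_diag z)) \<longlonglongrightarrow> h z * positive_powr \<alpha> (rho_diag z)"
      unfolding A_def
      by (intro AE_I2 ennreal_tendsto_cmult tendsto_average_positive_powr \<alpha>) (simp add: h_def)
  qed measurable
  then show ?thesis
    by (simp only: eq) (simp add: norm_pow_integral_eq_lborel h_def)
qed

text \<open>If every shift below \<open>\<epsilon>\<close> had norm integral at least
  \<open>c\<close>, so would the averages over short intervals, although their limit is less than
  \<open>c\<close>.\<close>

lemma exists_shift_norm_pow_integral_less: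
  fixes f :: "complex ^ 'n::{finite,linorder} \<Rightarrow> complex"
  assumes f: "f \<in> bergman_space p \<alpha>" and \<alpha>: "\<alpha> > - 1" and c: "norm_pow_integral p \<alpha> f < c" and \<epsilon>: "\<epsilon> > 0"
  shows "\<exists>v. 0 < v \<and> v < \<epsilon> \<and> norm_pow_integral p \<alpha> (\<lambda>z. f (z + of_real v *s i_point)) < c"
proof (rule ccontr)
  let ?H = "\<lambda>v. norm_pow_integral p \<alpha> (\<lambda>z. f (z + of_real v *s i_point))"
  assume no: "\<not> ?thesis"
  then have ge: "c \<le> ?H v" if "0 < v" "v < \<epsilon>" for v
    using no that not_le by blast
  have "\<forall>\<^sub>F m in sequentially. ennreal (real (Suc m)) * (\<integral>\<^sup>+ v. ?H v * indicator {0..1 / real (Suc m)} v \<partial>lborel) < c"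
    by (rule order_tendstoD(2)[OF tendsto_average_norm_pow_integral_shift[OF f \<alpha>] c])
  moreover have "(\<lambda>m. 1 / real (Suc m)) \<longlonglongrightarrow> 0"
    using LIMSEQ_inverse_real_of_nat by (simp add: inverse_eq_divide)
  then have "\<forall>\<^sub>F m in sequentially. 1 / real (Suc m) < \<epsilon>"
    using \<epsilon> order_tendstoD(2) by blast
  ultimately have "\<forall>\<^sub>F m in sequentially. False"
  proof eventually_elim
    case (elim m)
    have "c = ennreal (real (Suc m)) * (c * ennreal (1 / real (Suc m)))"
    proof -
      have "ennreal (real (Suc m)) * ennreal (1 / real (Suc m)) = 1"
        by (subst ennreal_mult[symmetric]) auto
      then show ?thesis by (simp only: mult.left_commute[of _ c] mult_1_right)
    qed
    \<comment> \<open>The left endpoint is dropped, at no cost in measure, because the lower bound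
      \<open>c\<close> is available only for positive shifts.\<close>
    also have "\<dots> = ennreal (real (Suc m)) * (\<integral>\<^sup>+ v. c * indicator {0<..1 / real (Suc m)} v \<partial>lborel)"
      by (subst nn_integral_cmult_indicator) auto
    also have "\<dots> \<le> ennreal (real (Suc m)) * (\<integral>\<^sup>+ v. ?H v * indicator {0..1 / real (Suc m)} v \<partial>lborel)"
      using elim(2) by (intro mult_left_mono nn_integral_mono) (auto simp: indicator_def intro!: ge)
    finally show False using elim(1) by simp
  qed
  then show False by simp
qed

text \<open>Shifts tending to 0 are chosen with norm integrals exceeding that of \<open>f\<close> by
  less than \<open>1 / Suc m\<close>. Continuity of \<open>f\<close> gives pointwise convergence,
  and \<open>tendsto_nn_integral_norm_diff_powr\<close> upgrades it to convergence in norm.\<close>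

lemma bergman_vertical_shift_approx:
  fixes f :: "complex ^ 'n::{finite,linorder} \<Rightarrow> complex"
  assumes f: "f \<in> bergman_space p \<alpha>" and \<alpha>: "\<alpha> > - 1" and p: "p > 0" and \<eta>: "\<eta> > 0"
  shows "\<exists>v>0. norm_pow_integral p \<alpha> (\<lambda>z. f (z + of_real v *s i_point)) < \<infinity> \<and>
    norm_pow_integral p \<alpha> (\<lambda>z. f (z + of_real v *s i_point) - f z) < \<eta>"
proof -
  let ?I = "norm_pow_integral p \<alpha>"
  note [measurable] = bergman_space_measurable[OF f]
  have fin: "?I f < \<infinity>" using f by (simp add: bergman_space_def)
  have "\<exists>v. 0 < v \<and> v < 1 / real (Suc m) \<and>
      ?I (\<lambda>z. f (z + of_real v *s i_point)) < ?I f + ennreal (1 / real (Suc m))" for m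
  proof (rule exists_shift_norm_pow_integral_less[OF f \<alpha>])
    \<comment> \<open>Finiteness is essential: adding a positive number to \<open>top\<close> would
      not increase it strictly.\<close>
    obtain a where "a \<ge> 0" "?I f = ennreal a"
      using fin by (cases "?I f" rule: ennreal_cases) auto
    then show "?I f < ?I f + ennreal (1 / real (Suc m))"
      by (simp add: ennreal_less_iff flip: ennreal_plus)
  qed simp
  then obtain v where v: "\<And>m. 0 < v m" "\<And>m. v m < 1 / real (Suc m)"
    "\<And>m. ?I (\<lambda>z. f (z + of_real (v m) *s i_point)) < ?I f + ennreal (1 / real (Suc m))"
    by metis
  have inv0: "(\<lambda>m. 1 / real (Suc m)) \<longlonglongrightarrow> 0"
    using LIMSEQ_inverse_real_of_nat by (simp add: inverse_eq_divide)
  have v0: "v \<longlonglongrightarrow> 0"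
    by (rule tendsto_sandwich[OF _ _ tendsto_const inv0])
       (use v in \<open>auto intro!: always_eventually less_imp_le\<close>)
  have finv: "?I (\<lambda>z. f (z + of_real (v m) *s i_point)) < \<infinity>" for m
    using less_trans[OF v(3)[of m], of \<infinity>] fin by simp
  have "(\<lambda>m. ?I (\<lambda>z. f (z + of_real (v m) *s i_point) - f z)) \<longlonglongrightarrow> 0"
    unfolding norm_pow_integral_def
  proof (rule tendsto_nn_integral_norm_diff_powr)
    show "(\<integral>\<^sup>+ z. ennreal (norm (f z) powr p) \<partial>dV \<alpha>) < \<infinity>"
      using fin by (simp add: norm_pow_integral_def)
    show "(\<integral>\<^sup>+ z. ennreal (norm (f (z + of_real (v m) *s i_point)) powr p) \<partial>dV \<alpha>) < \<infinity>" for m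
      using finv by (simp add: norm_pow_integral_def)
    show "AE z in dV \<alpha>. (\<lambda>m. f (z + of_real (v m) *s i_point)) \<longlonglongrightarrow> f z"
    proof (rule AE_I2)
      fix z :: "complex ^ 'n::{finite,linorder}" assume "z \<in> space (dV \<alpha>)"
      then have "z \<in> tube" by simp
      have "isCont f z"
        using f \<open>z \<in> tube\<close> holomorphic_several_continuous_on[of f tube]
          continuous_on_eq_continuous_at[OF open_tube, of f]
        by (auto simp: bergman_space_def)
      moreover have "(\<lambda>m. z + of_real (v m) *s i_point) \<longlonglongrightarrow> z"
      proof (rule vec_tendstoI)
        fix j
        have "(\<lambda>m. z $ j + of_real (v m) * i_point $ j) \<longlonglongrightarrow> z $ j + of_real 0 * i_point $ j"
          by (intro tendsto_intros v0)
        then show "(\<lambda>m. (z + of_real (v m) *s i_point) $ j) \<longlonglongrightarrow> z $ j" by simp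
      qed
      ultimately show "(\<lambda>m. f (z + of_real (v m) *s i_point)) \<longlonglongrightarrow> f z"
        by (rule isCont_tendsto_compose)
    qed
    have "limsup (\<lambda>m. ?I (\<lambda>z. f (z + of_real (v m) *s i_point))) \<le> limsup (\<lambda>m. ?I f + ennreal (1 / real (Suc m)))"
      using v(3) by (intro Limsup_mono always_eventually) (auto intro: less_imp_le)
    also have "(\<lambda>m. ?I f + ennreal (1 / real (Suc m))) \<longlonglongrightarrow> ?I f + ennreal 0"
      by (intro tendsto_add tendsto_const tendsto_ennrealI inv0)
    then have "limsup (\<lambda>m. ?I f + ennreal (1 / real (Suc m))) = ?I f"
      by (intro lim_imp_Limsup) auto
    finally show "limsup (\<lambda>m. \<integral>\<^sup>+ z. ennreal (norm (f (z + of_real (v m) *s i_point)) powr p) \<partial>dV \<alpha>)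
        \<le> (\<integral>\<^sup>+ z. ennreal (norm (f z) powr p) \<partial>dV \<alpha>)"
      by (simp add: norm_pow_integral_def)
  qed (use p in \<open>auto intro!: measurable_dV\<close>)
  then have "\<forall>\<^sub>F m in sequentially. ?I (\<lambda>z. f (z + of_real (v m) *s i_point) - f z) < \<eta>"
    using \<eta> order_tendstoD(2) by blast
  then obtain m where "?I (\<lambda>z. f (z + of_real (v m) *s i_point) - f z) < \<eta>"
    using eventually_happens trivial_limit_sequentially by blast
  with v(1) finv show ?thesis by blast
qed

section \<open>Density of functions with polynomial decay\<close>

lemma rho_diag_i_point [simp]: "rho_diag i_point = 1"
  by (simp add: rho_diag_eq i_point_def axis_def)

lemma norm_rho_i_point_ge: "(1 + rho_diag z) / 2 \<le> norm (rho z i_point)"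
  using Re_rho_ge[of z i_point] complex_Re_le_cmod[of "rho z i_point"] by simp

text \<open>This is the intersection of the Bergman space with the space \<open>S_t\<close> of
  functions of controlled decay, for \<open>t = s\<close>.\<close>

definition bergman_decay ::
    "real \<Rightarrow> real \<Rightarrow> real \<Rightarrow> (complex ^ 'n::{finite,linorder} \<Rightarrow> complex) set" where
  "bergman_decay p \<alpha> s =
     {f \<in> bergman_space p \<alpha>. \<exists>C. \<forall>z\<in>tube. norm (f z) \<le> C * norm (rho z i_point) powr (- s)}"

text \<open>First \<open>v\<close> is fixed so that the shifted function \<open>F\<close> is close
  to \<open>f\<close>; \<open>F\<close> then grows at most linearly. Multiplication by
  \<open>G m\<close> supplies the decay, and dominated convergence selects \<open>m\<close>.\<close>

lemma bergman_decay_dense: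
  fixes f :: "complex ^ 'n::{finite,linorder} \<Rightarrow> complex"
  assumes f: "f \<in> bergman_space p \<alpha>" and p: "1 \<le> p" and \<alpha>: "\<alpha> > - 1" and \<eta>: "\<eta> > 0"
  shows "\<exists>g\<in>bergman_decay p \<alpha> s. norm_pow_integral p \<alpha> (\<lambda>z. f z - g z) < \<eta>"
proof -
  let ?I = "norm_pow_integral p \<alpha>" and ?\<rho> = "\<lambda>z. rho z i_point"
  \<comment> \<open>The quasi-triangle inequality costs \<open>2 powr p\<close>; two errors below
    \<open>\<delta>\<close> then contribute at most half of a finite \<open>\<eta>\<close>.\<close>
  define \<delta> where "\<delta> = \<eta> / (ennreal (2 powr p) * 4)"
  have \<delta>: "\<delta> > 0" using \<eta> by (simp add: \<delta>_def ennreal_zero_less_divide ennreal_mult_less_top)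
  obtain v where v: "v > 0" and finv: "?I (\<lambda>z. f (z + of_real v *s i_point)) < \<infinity>"
    and close: "?I (\<lambda>z. f (z + of_real v *s i_point) - f z) < \<delta>"
    using bergman_vertical_shift_approx[OF f \<alpha> _ \<delta>] p by auto
  obtain C where C: "C \<ge> 0" "\<And>z. v \<le> rho_diag z \<Longrightarrow> norm (f z) \<le> C * (1 + rho_diag z)"
    using bergman_space_growth[OF f p \<alpha> v] by blast
  define F where "F z = (if z \<in> tube then f (z + of_real v *s i_point) else 0)" for z
  have F_le: "norm (F z) \<le> 2 * C * (1 + v) * norm (?\<rho> z)" if z: "z \<in> tube" for z
  proof -
    have "norm (F z) \<le> C * (1 + (rho_diag z + v))"
      using C(2)[of "z + of_real v *s i_point"] z by (simp add: F_def rho_diag_vertical_shift tube_iff)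
    also have "\<dots> \<le> C * ((1 + v) * (1 + rho_diag z))"
      using C(1) v z by (intro mult_left_mono) (auto simp: tube_iff algebra_simps)
    also have "\<dots> \<le> C * ((1 + v) * (2 * norm (?\<rho> z)))"
      using C(1) v norm_rho_i_point_ge[of z] by (intro mult_left_mono) auto
    finally show ?thesis by (simp only: mult_ac)
  qed
  have F: "F \<in> bergman_space p \<alpha>"
    unfolding bergman_space_def
  proof (intro CollectI conjI)
    have "holomorphic_several (\<lambda>z. f (z + of_real v *s i_point)) tube"
      unfolding holomorphic_several_def
    proof
      fix z :: "complex ^ 'n::{finite,linorder}" assume "z \<in> tube"
      then obtain D where D: "(f has_derivative D) (at (z + of_real v *s i_point))"
        and lin: "\<And>c v. D (c *s v) = c * D v"
        using f tube_vertical_shift[of z v] v unfolding bergman_space_def holomorphic_several_def by fastforce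
      have "((\<lambda>z. z + of_real v *s i_point) has_derivative (\<lambda>h. h)) (at z)"
        using has_derivative_add[OF has_derivative_ident has_derivative_const] by simp
      from diff_chain_at[OF this D] lin
      show "\<exists>D. ((\<lambda>z. f (z + of_real v *s i_point)) has_derivative D) (at z) \<and> (\<forall>c v. D (c *s v) = c * D v)"
        by (auto simp: o_def)
    qed
    then show "holomorphic_several F tube"
      by (rule holomorphic_several_transform[OF _ open_tube]) (simp add: F_def)
    have "?I F \<le> ?I (\<lambda>z. f (z + of_real v *s i_point))"
      using p by (intro norm_pow_integral_mono) (auto simp: F_def)
    then show "?I F < \<infinity>" using finv by simp
  qed (simp add: F_def)
  \<comment> \<open>One power absorbs the linear growth of \<open>F\<close>, and the remaining
    \<open>N - 1 \<ge> s\<close> powers give the decay; for \<open>s \<le> 0\<close> this is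
    \<open>N = 1\<close>.\<close>
  define N where "N = nat \<lceil>s\<rceil> + 1"
  have N: "s \<le> real N - 1" unfolding N_def by linarith
  \<comment> \<open>Since \<open>rho z i_point\<close> has nonnegative real part,
    \<open>q m z\<close> has modulus at least 1 on the tube; it tends to 1 as \<open>m\<close>
    grows. The integer exponent \<open>N\<close> in \<open>G\<close> requires no branch of a
    power.\<close>
  define q where "q m z = 1 + ?\<rho> z / of_real (real (Suc m))" for m and z :: "complex ^ 'n::{finite,linorder}"
  define G where "G m z = inverse (q m z) ^ N" for m z
  have q1: "1 \<le> norm (q m z)" and q2: "norm (?\<rho> z) / real (Suc m) \<le> norm (q m z)" if z: "z \<in> tube" for m z
  proof -
    have Re: "0 \<le> Re (?\<rho> z)"
      using Re_rho_ge[of z i_point] z by (simp add: tube_iff rho_diag_eq i_point_def axis_def)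
    define w where "w = ?\<rho> z / of_real (real (Suc m))"
    have w: "0 \<le> Re w" using Re by (simp add: w_def del: of_nat_Suc)
    have "1 \<le> Re (1 + w)" using w by simp
    then have "1 \<le> norm (1 + w)" using complex_Re_le_cmod[of "1 + w"] by linarith
    moreover have "norm w \<le> norm (1 + w)"
      using w by (simp add: cmod_def power2_eq_square algebra_simps)
    ultimately show "1 \<le> norm (q m z)" "norm (?\<rho> z) / real (Suc m) \<le> norm (q m z)"
      by (simp_all add: q_def w_def norm_divide del: of_nat_Suc)
  qed
  have G1: "norm (G m z) \<le> 1" if "z \<in> tube" for m z
  proof -
    have "norm (inverse (q m z)) \<le> 1"
      using q1[OF that, of m] by (simp add: norm_inverse inverse_le_1_iff)
    then show ?thesis by (simp add: G_def norm_power power_le_one)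
  qed
  have holG: "holomorphic_several (G m) tube" for m
  proof -
    have "holomorphic_several (\<lambda>z :: complex ^ 'n::{finite,linorder}. inverse (1 + ?\<rho> z * of_real (inverse (real (Suc m)))) ^ N) tube"
    proof (intro holomorphic_several_power holomorphic_several_inverse holomorphic_several_add
        holomorphic_several_mult holomorphic_several_const holomorphic_several_rho)
      fix z :: "complex ^ 'n::{finite,linorder}" assume "z \<in> tube"
      then show "1 + ?\<rho> z * of_real (inverse (real (Suc m))) \<noteq> 0"
        using q1[of z m] by (auto simp: q_def divide_inverse)
    qed
    then show ?thesis by (simp add: G_def[abs_def] q_def divide_inverse)
  qed
  have FG: "(\<lambda>z. F z * G m z) \<in> bergman_space p \<alpha>" for m
    using p by (intro bergman_space_mult_bounded F holG G1) auto
  have decay: "(\<lambda>z. F z * G m z) \<in> bergman_decay p \<alpha> s" for m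
  proof -
    let ?k = "real (Suc m)"
    \<comment> \<open>On the tube \<open>rho z i_point\<close> has modulus at least 1/2, and the
      exponent \<open>1 + s - N\<close> is at most 0, so the surplus power is at most
      \<open>?D\<close>.\<close>
    let ?D = "(1 / 2) powr (1 + s - real N)"
    have "norm (F z * G m z) \<le> (2 * C * (1 + v) * ?k ^ N * ?D) * norm (?\<rho> z) powr (- s)" if z: "z \<in> tube" for z
    proof -
      let ?x = "norm (?\<rho> z)"
      have x: "1 / 2 \<le> ?x" using norm_rho_i_point_ge[of z] z by (simp add: tube_iff)
      then have x0: "0 < ?x" by linarith
      have "norm (G m z) = inverse (norm (q m z)) ^ N" by (simp add: G_def norm_power norm_inverse)
      also have "\<dots> \<le> inverse (?x / ?k) ^ N"
        using q2[OF z, of m] x0 by (intro power_mono le_imp_inverse_le) (auto intro!: divide_pos_pos)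
      also have "\<dots> = ?k ^ N * ?x powr (- real N)"
        using x0 by (simp add: power_divide powr_minus powr_realpow divide_inverse power_mult_distrib power_inverse)
      finally have "norm (F z * G m z) \<le> (2 * C * (1 + v) * ?x) * (?k ^ N * ?x powr (- real N))"
        unfolding norm_mult using C(1) v by (intro mult_mono F_le z) auto
      also have "\<dots> = 2 * C * (1 + v) * ?k ^ N * (?x powr (1 + s - real N) * ?x powr (- s))"
      proof -
        have "?x * ?x powr (- real N) = ?x powr (1 + s - real N) * ?x powr (- s)"
          using x0 powr_add[of ?x 1 "- real N"] by (simp flip: powr_add)
        then show ?thesis by (simp only: mult_ac)
      qed
      also have "\<dots> \<le> 2 * C * (1 + v) * ?k ^ N * (?D * ?x powr (- s))"
        using C(1) v x N by (intro mult_left_mono mult_right_mono powr_mono2') auto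
      finally show ?thesis by (simp only: mult_ac)
    qed
    then show ?thesis using FG by (auto simp: bergman_decay_def)
  qed
  have lim: "(\<lambda>m. ?I (\<lambda>z. F z - F z * G m z)) \<longlonglongrightarrow> 0"
  proof -
    note [measurable] = bergman_space_measurable[OF F] bergman_space_measurable[OF FG]
    have mF: "(\<lambda>z. ennreal (norm (F z) powr p)) \<in> borel_measurable (dV \<alpha>)"
      by (intro measurable_dV) measurable
    have "(\<lambda>m. ?I (\<lambda>z. F z - F z * G m z)) \<longlonglongrightarrow> (\<integral>\<^sup>+ z. 0 \<partial>(dV \<alpha> :: (complex ^ 'n::{finite,linorder}) measure))"
      unfolding norm_pow_integral_def
    proof (rule nn_integral_dominated_convergence[where w = "\<lambda>z. ennreal (2 powr p) * ennreal (norm (F z) powr p)"])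
      show "AE z in dV \<alpha>. ennreal (norm (F z - F z * G m z) powr p) \<le> ennreal (2 powr p) * ennreal (norm (F z) powr p)" for m
      proof (rule AE_I2)
        fix z :: "complex ^ 'n::{finite,linorder}" assume "z \<in> space (dV \<alpha>)"
        then have z: "z \<in> tube" by simp
        have "norm (F z - F z * G m z) = norm (1 - G m z) * norm (F z)"
          by (simp add: right_diff_distrib mult.commute flip: norm_mult)
        also have "\<dots> \<le> 2 * norm (F z)"
          using G1[OF z, of m] norm_triangle_ineq4[of 1 "G m z"] by (intro mult_right_mono) auto
        finally have "norm (F z - F z * G m z) powr p \<le> (2 * norm (F z)) powr p"
          using p by (intro powr_mono2) auto
        then show "ennreal (norm (F z - F z * G m z) powr p) \<le> ennreal (2 powr p) * ennreal (norm (F z) powr p)"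
          by (simp add: powr_mult ennreal_leI flip: ennreal_mult)
      qed
      have "(\<integral>\<^sup>+ z. ennreal (2 powr p) * ennreal (norm (F z) powr p) \<partial>dV \<alpha>) = ennreal (2 powr p) * ?I F"
        unfolding norm_pow_integral_def by (rule nn_integral_cmult[OF mF])
      then show "(\<integral>\<^sup>+ z. ennreal (2 powr p) * ennreal (norm (F z) powr p) \<partial>dV \<alpha>) < \<infinity>"
        using F by (simp add: bergman_space_def ennreal_mult_less_top)
      show "AE z in dV \<alpha>. (\<lambda>m. ennreal (norm (F z - F z * G m z) powr p)) \<longlonglongrightarrow> 0"
      proof (rule AE_I2)
        fix z :: "complex ^ 'n::{finite,linorder}"
        have "(\<lambda>m. ?\<rho> z * of_real (inverse (real (Suc m)))) \<longlonglongrightarrow> ?\<rho> z * of_real 0"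
          by (intro tendsto_intros LIMSEQ_inverse_real_of_nat)
        then have "(\<lambda>m. q m z) \<longlonglongrightarrow> 1 + 0"
          unfolding q_def by (intro tendsto_add tendsto_const) (simp add: divide_inverse)
        then have "(\<lambda>m. norm (F z - F z * G m z)) \<longlonglongrightarrow> norm (F z - F z * inverse (1 + 0) ^ N)"
          unfolding G_def by (intro tendsto_intros) auto
        then have "(\<lambda>m. norm (F z - F z * G m z) powr p) \<longlonglongrightarrow> 0 powr p"
          using p by (intro tendsto_powr2 tendsto_const) auto
        from tendsto_ennrealI[OF this]
        show "(\<lambda>m. ennreal (norm (F z - F z * G m z) powr p)) \<longlonglongrightarrow> 0" by simp
      qed
    qed (intro measurable_dV, measurable)+
    then show ?thesis by simp
  qed
  obtain m where m: "?I (\<lambda>z. F z - F z * G m z) < \<delta>"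
    using order_tendstoD(2)[OF lim \<delta>] eventually_happens trivial_limit_sequentially by blast
  note meas [measurable] = bergman_space_measurable[OF f] bergman_space_measurable[OF F] bergman_space_measurable[OF FG]
  have close': "?I (\<lambda>z. f z - F z) < \<delta>"
    by (rule le_less_trans[OF norm_pow_integral_mono close])
       (use p in \<open>auto simp: F_def norm_minus_commute\<close>)
  have "?I (\<lambda>z. f z - F z * G m z) = ?I (\<lambda>z. (f z - F z) + (F z - F z * G m z))" by simp
  also have "\<dots> \<le> ennreal (2 powr p) * (?I (\<lambda>z. f z - F z) + ?I (\<lambda>z. F z - F z * G m z))"
    using p by (intro norm_pow_integral_add) auto
  also have "\<dots> < \<eta>"
  \<comment> \<open>Halving gives a strict inequality only for finite \<open>\<eta>\<close>; for
    infinite \<open>\<eta>\<close> finiteness of both errors is enough.\<close>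
  proof (cases \<eta> rule: ennreal_cases)
    case (real e)
    define d where "d = e / (2 powr p * 4)"
    have e: "e > 0" using real \<eta> by (cases "e = 0") auto
    have "\<delta> = ennreal d"
      using e by (simp add: \<delta>_def real d_def ennreal_mult ennreal_divide_numeral flip: divide_ennreal)
    then have "ennreal (2 powr p) * (?I (\<lambda>z. f z - F z) + ?I (\<lambda>z. F z - F z * G m z)) \<le> ennreal (2 powr p) * (ennreal d + ennreal d)"
      using close' m by (intro mult_left_mono add_mono) (auto intro: less_imp_le)
    also have "\<dots> = ennreal (e / 2)"
      using e by (simp add: d_def field_simps flip: ennreal_plus ennreal_mult)
    also have "\<dots> < ennreal e" using e by (simp add: ennreal_less_iff)
    finally show ?thesis by (simp add: real)
  next
    case top
    have "?I (\<lambda>z. f z - F z) < top" "?I (\<lambda>z. F z - F z * G m z) < top"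
      using close' m less_le_trans top_greatest by blast+
    then show ?thesis by (simp add: top ennreal_mult_less_top)
  qed
  finally show ?thesis
    using decay by (intro bexI[of _ "\<lambda>z. F z * G m z"])
qed

section \<open>Integrability against the kernel and the conclusion\<close>

text \<open>By \<open>Re_rho_ge\<close> the modulus of \<open>rho z w\<close> is at least
  \<open>rho_diag z / 2\<close> for all \<open>w\<close>, and for a real exponent the modulus of the
  power is the power of the modulus. The bound depends on \<open>z\<close>, which suffices for
  convergence at each point.\<close>

lemma norm_bergman_kernel_bounded:
  fixes z :: "complex ^ 'n::{finite,linorder}"
  assumes z: "z \<in> tube" and \<alpha>: "\<alpha> > - 1"
  shows "\<exists>A\<ge>0. \<forall>w\<in>tube. norm (bergman_kernel \<alpha> z w) \<le> A"
proof -
  let ?c = "real CARD('n) + \<alpha> + 1"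
  let ?g = "norm (complex_of_real (Gamma ?c))"
  let ?E = "norm (complex_of_real (2 ^ (CARD('n) + 1) * pi ^ CARD('n) * Gamma (\<alpha> + 1)))"
  have E: "?E > 0" using \<alpha> Gamma_real_pos[of "\<alpha> + 1"] by (simp add: norm_mult)
  have r: "0 < rho_diag z" using z by (simp add: tube_iff)
  have "norm (bergman_kernel \<alpha> z w) \<le> ?g / (?E * (rho_diag z / 2) powr ?c)" if w: "w \<in> tube" for w
  proof -
    have "rho_diag z / 2 \<le> norm (rho z w)"
      using Re_rho_ge[of z w] complex_Re_le_cmod[of "rho z w"] w by (simp add: tube_iff)
    then have "(rho_diag z / 2) powr ?c \<le> norm (rho z w) powr ?c"
      using r \<alpha> by (intro powr_mono2) auto
    also have "\<dots> = norm (rho z w powr complex_of_real ?c)"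
      by (simp add: norm_powr_real_powr')
    finally show ?thesis
      unfolding bergman_kernel_def norm_divide norm_mult[of _ "_ powr _"]
      using E r by (intro divide_left_mono mult_left_mono mult_pos_pos) auto
  qed
  moreover have "0 \<le> ?g / (?E * (rho_diag z / 2) powr ?c)" by simp
  ultimately show ?thesis by blast
qed

lemma nn_integral_bergman_kernel_decay:
  fixes z :: "complex ^ 'n::{finite,linorder}"
  assumes f: "f \<in> bergman_decay p \<alpha> s" and z: "z \<in> tube" and \<alpha>: "\<alpha> > - 1"
    and sets: "sets \<mu> = sets (restrict_space borel tube)"
    and fin: "(\<integral>\<^sup>+ w. ennreal (norm (rho w i_point) powr (- s)) \<partial>\<mu>) < \<infinity>"
  shows "(\<integral>\<^sup>+ w. ennreal (norm (bergman_kernel \<alpha> z w * f w)) \<partial>\<mu>) < \<infinity>"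
proof -
  have space: "space \<mu> = tube" using sets_eq_imp_space_eq[OF sets] by (simp add: space_restrict_space)
  obtain A where A: "A \<ge> 0" "\<And>w. w \<in> tube \<Longrightarrow> norm (bergman_kernel \<alpha> z w) \<le> A"
    using norm_bergman_kernel_bounded[OF z \<alpha>] by blast
  obtain C where C: "\<And>w. w \<in> tube \<Longrightarrow> norm (f w) \<le> C * norm (rho w i_point) powr (- s)"
    using f by (auto simp: bergman_decay_def)
  have [measurable]: "(\<lambda>w. rho w i_point) \<in> borel_measurable (borel :: (complex ^ 'n::{finite,linorder}) measure)"
    by (intro borel_measurable_continuous_onI holomorphic_several_continuous_on holomorphic_several_rho)
  have "(\<lambda>w :: complex ^ 'n::{finite,linorder}. ennreal (norm (rho w i_point) powr (- s))) \<in> borel_measurable (restrict_space borel tube)"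
    by (intro measurable_restrict_space1) measurable
  then have meas: "(\<lambda>w. ennreal (norm (rho w i_point) powr (- s))) \<in> borel_measurable \<mu>"
    using measurable_cong_sets[OF sets refl] by blast
  have "(\<integral>\<^sup>+ w. ennreal (norm (bergman_kernel \<alpha> z w * f w)) \<partial>\<mu>)
      \<le> (\<integral>\<^sup>+ w. ennreal (A * \<bar>C\<bar>) * ennreal (norm (rho w i_point) powr (- s)) \<partial>\<mu>)"
  proof (rule nn_integral_mono)
    fix w assume "w \<in> space \<mu>"
    then have w: "w \<in> tube" by (simp add: space)
    \<comment> \<open>The definition of the decay space does not fix the sign of \<open>C\<close>;
      the absolute value makes the constant usable in \<open>ennreal\<close>.\<close>
    have "norm (f w) \<le> \<bar>C\<bar> * norm (rho w i_point) powr (- s)"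
      by (rule order_trans[OF C[OF w]]) (auto intro: mult_right_mono)
    then have "norm (bergman_kernel \<alpha> z w * f w) \<le> A * (\<bar>C\<bar> * norm (rho w i_point) powr (- s))"
      unfolding norm_mult using A w by (intro mult_mono) auto
    then show "ennreal (norm (bergman_kernel \<alpha> z w * f w)) \<le> ennreal (A * \<bar>C\<bar>) * ennreal (norm (rho w i_point) powr (- s))"
      using A(1) by (simp add: ennreal_leI mult.assoc flip: ennreal_mult)
  qed
  also have "\<dots> = ennreal (A * \<bar>C\<bar>) * (\<integral>\<^sup>+ w. ennreal (norm (rho w i_point) powr (- s)) \<partial>\<mu>)"
    by (rule nn_integral_cmult[OF meas])
  also have "\<dots> < \<infinity>" using fin by (simp add: ennreal_mult_less_top)
  finally show ?thesis .
qed

lemma dense_linear_subspace_bergman_decay: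
  assumes p: "1 \<le> p" and \<alpha>: "\<alpha> > - 1"
  shows "dense_linear_subspace p \<alpha> (bergman_decay p \<alpha> s :: (complex ^ 'n::{finite,linorder} \<Rightarrow> complex) set)"
  unfolding dense_linear_subspace_def
proof (intro conjI ballI allI impI)
  show "bergman_decay p \<alpha> s \<subseteq> bergman_space p \<alpha>" by (auto simp: bergman_decay_def)
  have "(\<lambda>z. 0) \<in> bergman_space p \<alpha>"
    by (simp add: bergman_space_def holomorphic_several_const norm_pow_integral_def)
  then show "(\<lambda>z. 0) \<in> bergman_decay p \<alpha> s"
    by (auto simp: bergman_decay_def intro!: exI[of _ 0])
next
  fix f g :: "complex ^ 'n::{finite,linorder} \<Rightarrow> complex"
  assume "f \<in> bergman_decay p \<alpha> s" "g \<in> bergman_decay p \<alpha> s"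
  then obtain C D where fg: "f \<in> bergman_space p \<alpha>" "g \<in> bergman_space p \<alpha>"
    and C: "\<And>z. z \<in> tube \<Longrightarrow> norm (f z) \<le> C * norm (rho z i_point) powr (- s)"
    and D: "\<And>z. z \<in> tube \<Longrightarrow> norm (g z) \<le> D * norm (rho z i_point) powr (- s)"
    unfolding bergman_decay_def by blast
  have "norm (f z + g z) \<le> (C + D) * norm (rho z i_point) powr (- s)" if "z \<in> tube" for z
    using norm_triangle_ineq[of "f z" "g z"] C[OF that] D[OF that] by (simp add: distrib_right)
  then show "(\<lambda>z. f z + g z) \<in> bergman_decay p \<alpha> s"
    using fg p unfolding bergman_decay_def by (auto intro: bergman_space_add)
next
  fix c and f :: "complex ^ 'n::{finite,linorder} \<Rightarrow> complex"
  assume "f \<in> bergman_decay p \<alpha> s"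
  then obtain C where f: "f \<in> bergman_space p \<alpha>"
    and C: "\<And>z. z \<in> tube \<Longrightarrow> norm (f z) \<le> C * norm (rho z i_point) powr (- s)"
    unfolding bergman_decay_def by blast
  have "norm (c * f z) \<le> (norm c * C) * norm (rho z i_point) powr (- s)" if "z \<in> tube" for z
    using mult_left_mono[OF C[OF that], of "norm c"] by (simp add: norm_mult mult.assoc)
  then show "(\<lambda>z. c * f z) \<in> bergman_decay p \<alpha> s"
    using f unfolding bergman_decay_def by (auto intro: bergman_space_cmult)
next
  fix f :: "complex ^ 'n::{finite,linorder} \<Rightarrow> complex" and \<epsilon> :: real
  assume f: "f \<in> bergman_space p \<alpha>" and \<epsilon>: "\<epsilon> > 0"
  obtain g where g: "g \<in> bergman_decay p \<alpha> s"
    "norm_pow_integral p \<alpha> (\<lambda>z. f z - g z) < ennreal (\<epsilon> powr p)"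
    \<comment> \<open>The tolerance is \<open>\<epsilon> powr p\<close> because the norm is the
      \<open>p\<close>-th root of the integral.\<close>
    using bergman_decay_dense[OF f p \<alpha>, of "ennreal (\<epsilon> powr p)" s] \<epsilon> by auto
  let ?x = "enn2real (norm_pow_integral p \<alpha> (\<lambda>z. f z - g z))"
  have "?x < \<epsilon> powr p"
    using g(2) \<epsilon> by (cases "norm_pow_integral p \<alpha> (\<lambda>z. f z - g z)" rule: ennreal_cases)
      (auto simp: ennreal_less_iff)
  then have "?x powr (1 / p) < (\<epsilon> powr p) powr (1 / p)"
    using p by (intro powr_less_mono2) auto
  also have "\<dots> = \<epsilon>" using \<epsilon> p by (simp add: powr_powr)
  finally show "\<exists>g\<in>bergman_decay p \<alpha> s. bergman_norm p \<alpha> (\<lambda>z. f z - g z) < \<epsilon>"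
    using g(1) unfolding bergman_norm_def by blast
qed

theorem theorem5p1:
  fixes p \<alpha> t :: real
    and \<mu> :: "(complex ^ 'n::{finite,linorder}) measure"
  assumes "1 \<le> p"
    and "\<alpha> > -1"
    and "t > real CARD('n) + (\<alpha> + 1) / p"
    and "\<mu> \<in> M_plus"
  shows "toeplitz_densely_defined p \<alpha> \<mu>"
proof -
  \<comment> \<open>The exponent for which \<open>\<mu>\<close> integrates the power of
    \<open>rho\<close> also serves as the decay rate of the dense subspace, so the subspace depends
    on \<open>\<mu>\<close>.\<close>
  obtain s where sets: "sets \<mu> = sets (restrict_space borel tube)"
    and fin: "(\<integral>\<^sup>+ z. ennreal (norm (rho z i_point) powr (- s)) \<partial>\<mu>) < \<infinity>"
    using assms(4) by (auto simp: M_plus_def)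
  show ?thesis
    unfolding toeplitz_densely_defined_def
    using dense_linear_subspace_bergman_decay[OF assms(1,2), of s]
      nn_integral_bergman_kernel_decay[OF _ _ assms(2) sets fin]
    by blast
qed

end
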